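(* Let $\ell\in\mathbb{N}$, let $f\in\mathcal{F}_\ell$ and define $W:=\Delta^{\ell-1}f$. Then for any invertible probability measure preserving system $(X,\mathcal{B},\mu,T)$, any $A\in\mathcal{B}$ and any $\epsilon>0$ the set $$R_{\epsilon,A}=\big\{n\in\mathbb{N}:\mu(A\cap T^{-\lfloor f(n)\rfloor}A)>\mu(A)^2-\epsilon\big\}$$ is thick and $W$-syndetic.
   Context: $\mathbb{N}=\{1,2,3,\dots\}$ and $\lfloor x\rfloor$ is the integer part (floor) of $x$. For $f:\mathbb{N}\to\mathbb{R}$ put $\Delta f(n)=f(n+1)-f(n)$, $\Delta^0f=f$, $\Delta^{i+1}f=\Delta(\Delta^i f)$. Define $\mathcal{F}_0=\{f:\mathbb{N}\to\mathbb{R}:\ \lim_{n\to\infty}f(n)=0,\ f(n)\text{ is eventually monotone, and } |\sum_{n=1}^\infty f(n)|=\infty\}$ and, for $\ell\in\mathbb{N}\cup\{0\}$, $\mathcal{F}_{\ell+1}=\{f:\mathbb{N}\to\mathbb{R}:\Delta f\in\mathcal{F}_\ell\}$. A set $R\subset\mathbb{N}$ is called thick if it contains arbitrarily long intervals (of consecutive integers). Definition of $W$-syndetic: let $W\in\mathcal{F}_1\cup\{\mathrm{Id}:n\mapsto n\}$ be positive. A set $R\subset\mathbb{N}$ is called $W$-syndetic if there exists $l\in\mathbb{N}$ such that for any interval $[M,N]\subset\mathbb{N}$ with $W(N)-W(M)\ge l$ one has $\sum_{n\in R\cap[M,N]}\Delta W(n)\ge1$. *)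

theory Defs
  imports "HOL-Probability.Probability"
begin

text \<open>
  Functions on the positive integers are represented by functions of type
  \<^typ>\<open>nat \<Rightarrow> real\<close>; the value at 0 is never inspected by the definitions below.
\<close>

definition fdiff :: "(nat \<Rightarrow> real) \<Rightarrow> nat \<Rightarrow> real" where
  "fdiff f n = f (n + 1) - f n"

text \<open>
  For an eventually monotone null sequence the terms eventually have constant sign, so the series
  has a value in the extended reals; the modulus of that value is infinite iff the moduli of the
  partial sums tend to infinity.
\<close>

definition class_F0 :: "(nat \<Rightarrow> real) set" where
  "class_F0 = {f. f \<longlonglongrightarrow> 0
     \<and> (\<exists>n0\<ge>1. mono_on {n0..} f \<or> antimono_on {n0..} f)
     \<and> filterlim (\<lambda>N. \<bar>\<Sum>n=1..N. f n\<bar>) at_top sequentially}"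

primrec class_F :: "nat \<Rightarrow> (nat \<Rightarrow> real) set" where
  "class_F 0 = class_F0"
| "class_F (Suc l) = {f. fdiff f \<in> class_F l}"

definition thick :: "nat set \<Rightarrow> bool" where
  "thick R \<longleftrightarrow> (\<forall>L. \<exists>M\<ge>1. {M..<M + L} \<subseteq> R)"

text \<open>
  The notion is intended for positive \<open>W\<close> that are the identity or belong to
  \<^term>\<open>class_F 1\<close>, but its defining formula makes sense for every \<open>W\<close>.
\<close>

definition syndetic_wrt :: "(nat \<Rightarrow> real) \<Rightarrow> nat set \<Rightarrow> bool" where
  "syndetic_wrt W R \<longleftrightarrow>
     (\<exists>l::nat. l \<ge> 1 \<and>
       (\<forall>M N. 1 \<le> M \<and> M \<le> N \<and> W N - W M \<ge> real l \<longrightarrow> (\<Sum>n\<in>R \<inter> {M..N}. fdiff W n) \<ge> 1))"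

locale invertible_pmp_system = prob_space M for M :: "'a measure" +
  fixes T :: "'a \<Rightarrow> 'a"
  assumes T_bij: "bij_betw T (space M) (space M)"
    and T_measurable: "T \<in> measurable M M"
    and T_inv_measurable: "inv_into (space M) T \<in> measurable M M"
    and T_preserving: "\<And>B. B \<in> sets M \<Longrightarrow> measure M (T -` B \<inter> space M) = measure M B"

text \<open>
  The integer iterates of a bijection of \<open>X\<close>; only their values on \<open>X\<close> are meaningful.
\<close>

definition int_iterate :: "'a set \<Rightarrow> ('a \<Rightarrow> 'a) \<Rightarrow> int \<Rightarrow> 'a \<Rightarrow> 'a" where
  "int_iterate X T k = (if k \<ge> 0 then T ^^ nat k else inv_into X T ^^ nat (- k))"

end

theory Submission
  imports Defs "HOL-Real_Asymp.Real_Asymp"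
begin

text \<open>
  By the theorem of Herglotz the numbers \<open>\<mu>(A \<inter> T\<^sup>-\<^sup>m A) - \<mu>(A)\<^sup>2\<close>, \<open>m \<noteq> 0\<close>, are Fourier coefficients
  of a positive measure \<open>\<nu>\<close> on the circle. Averages with the weights \<open>\<bar>\<Delta>W\<bar>\<close> over intervals of
  growing mass satisfy van der Corput's inequality, because the weights are monotone; it lowers the degree
  of \<open>f\<close> until \<open>\<Sum> \<Delta>W(n) cis (c W(n))\<close> is left, a Riemann sum for the integral of \<open>cis (c t)\<close>. Hence
  for every real combination \<open>g\<close> of translates of \<open>f\<close> the average of \<open>cis g\<close> tends to 0 or to 1.

  Split \<open>\<nu>\<close> into finitely many atoms, an atomic tail of small mass and a continuous part. The product
  \<open>\<Phi>(n)\<close> of high powers of \<open>(1 + cos (x (f(n+i) - 1/2))) / 2\<close>, where \<open>x\<close> ranges over those atoms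
  and \<open>2\<pi>\<close>, has nonnegative Fourier coefficients, so its mean is at least its constant coefficient.
  Where \<open>\<Phi>(n)\<close> is not tiny, \<open>f(n+i)\<close> is near a half-integer, which determines its floor, and the
  atoms contribute nonnegatively. By Wiener's argument the contribution of the continuous part tends to 0
  in quadratic mean. So the \<open>n\<close> with \<open>n, ..., n+L-1\<close> all in \<open>R\<close> have positive lower weighted
  density along every sequence of intervals of growing mass, and both conclusions follow.
\<close>

section \<open>Averages with monotone weights\<close>

lemma fdiff_funpow_shift: "(fdiff ^^ l) (\<lambda>n. f (n + i)) n = (fdiff ^^ l) f (n + i)"
  by (induction l arbitrary: n) (simp_all add: fdiff_def)

lemma fdiff_funpow_cmult: "(fdiff ^^ l) (\<lambda>n. c * f n) n = c * (fdiff ^^ l) f n"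
  by (induction l arbitrary: n) (simp_all add: fdiff_def algebra_simps)

lemma fdiff_funpow_sum:
  "(fdiff ^^ l) (\<lambda>n. \<Sum>i\<in>I. f i n) n = (\<Sum>i\<in>I. (fdiff ^^ l) (f i) n)"
  by (induction l arbitrary: n) (simp_all add: fdiff_def sum_subtractf)

lemma fdiff_funpow_diff: "(fdiff ^^ l) (\<lambda>n. f n - g n) n = (fdiff ^^ l) f n - (fdiff ^^ l) g n"
  by (induction l arbitrary: n) (simp_all add: fdiff_def)

lemma sum_fdiff_telescope: "(\<Sum>j<i. fdiff f (n + j)) = f (n + i) - f n"
  by (induction i) (simp_all add: fdiff_def)

lemma norm_cis_diff_le: "norm (cis a - cis b) \<le> \<bar>a - b\<bar>"
proof -
  have "cis a - cis b = cis b * (cis (a - b) - 1)"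
    by (simp add: algebra_simps cis_mult)
  then have "norm (cis a - cis b) = norm (iexp (a - b) - (\<Sum>k\<le>0. (\<i> * complex_of_real (a - b)) ^ k / fact k))"
    by (simp add: norm_mult cis_conv_exp)
  also have "\<dots> \<le> \<bar>a - b\<bar>"
    using iexp_approx1[of "a - b" 0] by simp
  finally show ?thesis .
qed

text \<open>The intervals are arbitrary apart from their diverging mass: thickness will use initial
  segments, syndeticity a sequence of bad intervals. Writing the weights as increments of
  \<open>V\<close> lets them telescope.\<close>

locale weighted_averages =
  fixes V :: "nat \<Rightarrow> real" and A B :: "nat \<Rightarrow> nat"
  assumes w_nonneg: "fdiff V n \<ge> 0"
    and w_antimono: "decseq (fdiff V)"
    and w_null: "fdiff V \<longlonglongrightarrow> 0"
    and mass_at_top: "filterlim (\<lambda>k. \<Sum>n=A k..<B k. fdiff V n) at_top sequentially"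
begin

definition mass :: "nat \<Rightarrow> real" where
  "mass k = (\<Sum>n=A k..<B k. fdiff V n)"

text \<open>Division by zero makes the average 0 when the mass vanishes, which happens for only
  finitely many \<open>k\<close>.\<close>

definition av :: "(nat \<Rightarrow> complex) \<Rightarrow> nat \<Rightarrow> complex" where
  "av u k = (\<Sum>n=A k..<B k. complex_of_real (fdiff V n) * u n) / complex_of_real (mass k)"

lemma filterlim_mass: "filterlim mass at_top sequentially"
  using mass_at_top unfolding mass_def .

lemma eventually_mass_pos: "\<forall>\<^sub>F k in sequentially. mass k > 0"
  using filterlim_mass by (auto simp: filterlim_at_top_dense)

lemma mass_nonneg: "mass k \<ge> 0"
  unfolding mass_def by (intro sum_nonneg) (auto simp: w_nonneg)

lemma const_over_mass: "(\<lambda>k. c / mass k) \<longlonglongrightarrow> 0"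
  by (rule real_tendsto_divide_at_top[OF tendsto_const filterlim_mass])

lemma norm_av_le:
  assumes "\<And>n. norm (u n) \<le> c" "c \<ge> 0"
  shows "norm (av u k) \<le> c"
proof (cases "mass k = 0")
  case False
  have "norm (\<Sum>n=A k..<B k. complex_of_real (fdiff V n) * u n) \<le> (\<Sum>n=A k..<B k. fdiff V n * c)"
    by (intro sum_norm_le) (auto simp: norm_mult w_nonneg assms intro!: mult_left_mono)
  also have "\<dots> = mass k * c"
    by (simp add: mass_def sum_distrib_right)
  finally show ?thesis
    using False mass_nonneg[of k] by (simp add: av_def norm_divide field_simps)
qed (simp add: av_def assms)

lemma av_diff: "av (\<lambda>n. u n - v n) k = av u k - av v k"
  by (simp add: av_def algebra_simps sum_subtractf diff_divide_distrib)

lemma av_cmult: "av (\<lambda>n. c * u n) k = c * av u k"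
  by (simp add: av_def sum_distrib_left mult_ac)

lemma av_sum: "av (\<lambda>n. \<Sum>i\<in>I. u i n) k = (\<Sum>i\<in>I. av (u i) k)"
proof -
  have "(\<Sum>n=A k..<B k. complex_of_real (fdiff V n) * (\<Sum>i\<in>I. u i n))
      = (\<Sum>i\<in>I. \<Sum>n=A k..<B k. complex_of_real (fdiff V n) * u i n)"
    unfolding sum_distrib_left by (rule sum.swap)
  then show ?thesis
    unfolding av_def by (simp add: sum_divide_distrib)
qed

lemma av_of_real:
  "av (\<lambda>n. complex_of_real (u n)) k = complex_of_real ((\<Sum>n=A k..<B k. fdiff V n * u n) / mass k)"
  by (simp add: av_def)

lemma av_const: "av (\<lambda>n. c) \<longlonglongrightarrow> c"
proof -
  have "\<forall>\<^sub>F k in sequentially. av (\<lambda>n. c) k = c"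
    using eventually_mass_pos
  proof eventually_elim
    case (elim k)
    have "(\<Sum>n=A k..<B k. complex_of_real (fdiff V n) * c) = complex_of_real (mass k) * c"
      by (simp add: mass_def sum_distrib_right)
    then show ?case using elim by (simp add: av_def)
  qed
  then show ?thesis by (rule tendsto_eventually)
qed

lemma av_tendsto_zeroI:
  assumes "\<And>k. norm (\<Sum>n=A k..<B k. complex_of_real (fdiff V n) * u n) \<le> c"
  shows "av u \<longlonglongrightarrow> 0"
proof (rule Lim_null_comparison[OF _ const_over_mass[of c]])
  show "\<forall>\<^sub>F k in sequentially. norm (av u k) \<le> c / mass k"
    using eventually_mass_pos
    by eventually_elim (simp add: av_def norm_divide divide_right_mono assms)
qed

lemma av_null_sequence:
  assumes "u \<longlonglongrightarrow> 0"
  shows "av u \<longlonglongrightarrow> 0"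
proof (rule LIMSEQ_I)
  fix e :: real assume e: "e > 0"
  obtain m where m: "\<And>n. n \<ge> m \<Longrightarrow> norm (u n) < e / 2"
    using LIMSEQ_D[OF assms, of "e / 2"] e by auto
  \<comment> \<open>The intervals need not move to infinity, so the head of \<open>u\<close> is
    treated apart: its weighted sums are bounded uniformly in \<open>k\<close>.\<close>
  define v where "v = (\<lambda>n. if n < m then u n else 0)"
  have "av v \<longlonglongrightarrow> 0"
  proof (rule av_tendsto_zeroI)
    fix k
    have "norm (\<Sum>n=A k..<B k. complex_of_real (fdiff V n) * v n)
        \<le> (\<Sum>n=A k..<B k. norm (complex_of_real (fdiff V n) * v n))"
      by (rule norm_sum)
    also have "\<dots> = (\<Sum>n\<in>{A k..<B k} \<inter> {..<m}. norm (complex_of_real (fdiff V n) * v n))"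
      by (rule sum.mono_neutral_right) (auto simp: v_def)
    also have "\<dots> \<le> (\<Sum>n<m. norm (complex_of_real (fdiff V n) * v n))"
      by (rule sum_mono2) auto
    finally show "norm (\<Sum>n=A k..<B k. complex_of_real (fdiff V n) * v n)
        \<le> (\<Sum>n<m. norm (complex_of_real (fdiff V n) * v n))" .
  qed
  then obtain k0 where k0: "\<And>k. k \<ge> k0 \<Longrightarrow> norm (av v k) < e / 2"
    using LIMSEQ_D[of "av v" 0 "e / 2"] e by auto
  have "norm (av u k) < e" if "k \<ge> k0" for k
  proof -
    have "norm (av (\<lambda>n. u n - v n) k) \<le> e / 2"
      by (rule norm_av_le) (use m e in \<open>auto simp: v_def not_less intro: less_imp_le\<close>)
    then have "norm (av u k - av v k) \<le> e / 2" by (simp add: av_diff)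
    then show ?thesis
      using k0[OF that] norm_triangle_ineq[of "av u k - av v k" "av v k"] by simp
  qed
  then show "\<exists>k0. \<forall>k\<ge>k0. norm (av u k - 0) < e" by auto
qed

lemma av_cong_null:
  assumes "(\<lambda>n. u n - v n) \<longlonglongrightarrow> 0" "av v \<longlonglongrightarrow> z"
  shows "av u \<longlonglongrightarrow> z"
  using tendsto_add[OF av_null_sequence[OF assms(1)] assms(2)] by (simp add: av_diff)

text \<open>Summation by parts moves the shift onto the weights. These decrease, so their total
  variation is at most \<open>fdiff V 0\<close>, and the weighted sums of
  \<open>u (Suc n) - u n\<close> stay bounded while the mass diverges.\<close>

lemma av_shift_Suc:
  assumes "\<And>n. norm (u n) \<le> 1"
  shows "(\<lambda>k. av (\<lambda>n. u (Suc n)) k - av u k) \<longlonglongrightarrow> 0"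
proof -
  have part: "norm (\<Sum>n=a..<b. complex_of_real (fdiff V n) * (u (Suc n) - u n)) \<le> 3 * fdiff V 0" for a b
  proof (cases "a \<le> b")
    case True
    have le: "fdiff V n \<le> fdiff V 0" for n
      using w_antimono by (simp add: decseq_def)
    have nrm: "norm (complex_of_real (fdiff V n) * u m) \<le> fdiff V n" for n m
      using mult_left_mono[OF assms[of m] w_nonneg[of n]] by (simp add: norm_mult w_nonneg)
    have "(\<Sum>n=a..<b. complex_of_real (fdiff V n) * (u (Suc n) - u n))
       = (\<Sum>n=a..<b. (fdiff V (Suc n) * u (Suc n) - fdiff V n * u n)
            + complex_of_real (fdiff V n - fdiff V (Suc n)) * u (Suc n))"
      by (rule sum.cong) (auto simp: algebra_simps)
    also have "\<dots> = fdiff V b * u b - fdiff V a * u a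
        + (\<Sum>n=a..<b. complex_of_real (fdiff V n - fdiff V (Suc n)) * u (Suc n))"
      using sum_Suc_diff'[OF True, of "\<lambda>n. complex_of_real (fdiff V n) * u n"]
      by (simp add: sum.distrib)
    also have "norm \<dots> \<le> norm (fdiff V b * u b) + norm (fdiff V a * u a)
        + norm (\<Sum>n=a..<b. complex_of_real (fdiff V n - fdiff V (Suc n)) * u (Suc n))"
      by (meson add_right_mono norm_triangle_ineq norm_triangle_ineq4 order_trans)
    also have "norm (\<Sum>n=a..<b. complex_of_real (fdiff V n - fdiff V (Suc n)) * u (Suc n))
        \<le> (\<Sum>n=a..<b. fdiff V n - fdiff V (Suc n))"
    proof (rule sum_norm_le)
      fix n
      have "fdiff V n - fdiff V (Suc n) \<ge> 0"
        using w_antimono by (simp add: decseq_Suc_iff)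
      from mult_left_mono[OF assms[of "Suc n"] this] this
      show "norm (complex_of_real (fdiff V n - fdiff V (Suc n)) * u (Suc n)) \<le> fdiff V n - fdiff V (Suc n)"
        by (simp add: norm_mult del: of_real_diff)
    qed
    also have "(\<Sum>n=a..<b. fdiff V n - fdiff V (Suc n)) = fdiff V a - fdiff V b"
      using sum_Suc_diff'[OF True, of "\<lambda>n. - fdiff V n"] by (simp add: algebra_simps)
    finally show ?thesis
      using nrm[of b b] nrm[of a a] le[of a] le[of b] w_nonneg[of b] by linarith
  qed (simp add: w_nonneg)
  have "av (\<lambda>n. u (Suc n) - u n) \<longlonglongrightarrow> 0"
    by (rule av_tendsto_zeroI[OF part])
  then show ?thesis by (simp add: av_diff[abs_def])
qed

lemma av_shift:
  assumes "\<And>n. norm (u n) \<le> 1"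
  shows "(\<lambda>k. av (\<lambda>n. u (n + h)) k - av u k) \<longlonglongrightarrow> 0"
proof (induction h)
  case (Suc h)
  from tendsto_add[OF av_shift_Suc[of "\<lambda>n. u (n + h)"] Suc] assms show ?case by simp
qed simp

section \<open>Van der Corput's inequality and the linear exponential sum\<close>

lemma norm_av_power2_le: "(norm (av u k))\<^sup>2 \<le> Re (av (\<lambda>n. u n * cnj (u n)) k)"
proof (cases "mass k = 0")
  case False
  then have pos: "mass k > 0" using mass_nonneg[of k] by simp
  have "norm (\<Sum>n=A k..<B k. complex_of_real (fdiff V n) * u n)
      \<le> (\<Sum>n=A k..<B k. sqrt (fdiff V n) * (sqrt (fdiff V n) * norm (u n)))"
    by (rule sum_norm_le) (simp add: norm_mult w_nonneg flip: mult.assoc)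
  then have "(norm (\<Sum>n=A k..<B k. complex_of_real (fdiff V n) * u n))\<^sup>2
      \<le> (\<Sum>n=A k..<B k. sqrt (fdiff V n) * (sqrt (fdiff V n) * norm (u n)))\<^sup>2"
    by (rule power_mono) simp
  also have "\<dots> \<le> (\<Sum>n=A k..<B k. (sqrt (fdiff V n))\<^sup>2) * (\<Sum>n=A k..<B k. (sqrt (fdiff V n) * norm (u n))\<^sup>2)"
    by (rule Cauchy_Schwarz_ineq_sum)
  also have "\<dots> = mass k * (\<Sum>n=A k..<B k. fdiff V n * (norm (u n))\<^sup>2)"
    by (simp add: power_mult_distrib w_nonneg mass_def)
  finally have *: "(norm (\<Sum>n=A k..<B k. complex_of_real (fdiff V n) * u n))\<^sup>2
      \<le> mass k * (\<Sum>n=A k..<B k. fdiff V n * (norm (u n))\<^sup>2)" .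
  have "(norm (av u k))\<^sup>2 = (norm (\<Sum>n=A k..<B k. complex_of_real (fdiff V n) * u n))\<^sup>2 / (mass k)\<^sup>2"
    using pos by (simp add: av_def norm_divide power_divide)
  also have "\<dots> \<le> (mass k * (\<Sum>n=A k..<B k. fdiff V n * (norm (u n))\<^sup>2)) / (mass k)\<^sup>2"
    by (rule divide_right_mono[OF *]) simp
  also have "\<dots> = (\<Sum>n=A k..<B k. fdiff V n * (norm (u n))\<^sup>2) / mass k"
    using pos by (simp add: power2_eq_square)
  also have "\<dots> = Re (av (\<lambda>n. u n * cnj (u n)) k)"
    by (simp add: complex_norm_square[symmetric] av_of_real del: of_real_power)
  finally show ?thesis .
qed (simp add: av_def)

text \<open>Averaging \<open>u\<close> over \<open>H\<close> shifts does not change its mean in the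
  limit. By Cauchy-Schwarz the squared mean is at most the mean square of the averaged sequence,
  where only the \<open>H\<close> diagonal correlations out of \<open>H * H\<close> survive, leaving
  \<open>1 / H\<close>.\<close>

lemma van_der_corput:
  assumes unit: "\<And>n. norm (u n) = 1"
    and corr: "\<And>h k. h \<noteq> k \<Longrightarrow> av (\<lambda>n. u (n + h) * cnj (u (n + k))) \<longlonglongrightarrow> 0"
  shows "av u \<longlonglongrightarrow> 0"
proof (rule LIMSEQ_I)
  fix e :: real assume e: "e > 0"
  \<comment> \<open>Makes the limit \<open>1 / H\<close> smaller than
    \<open>(e / 2)\<^sup>2\<close>; the other half of \<open>e\<close> pays for the shifts.\<close>
  obtain H :: nat where H: "real H > 8 / e\<^sup>2" using reals_Archimedean2 by blast
  then have Hpos: "H > 0" using e by (metis divide_pos_pos gr0I less_asym of_nat_0 zero_less_numeral zero_less_power)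
  define v where "v = (\<lambda>n. (1 / of_nat H) * (\<Sum>h<H. u (n + h)))"
  have "(\<lambda>k. (1 / of_nat H) * (\<Sum>h<H. av (\<lambda>n. u (n + h)) k - av u k)) \<longlonglongrightarrow> (1 / of_nat H) * (\<Sum>h<H. 0)"
    by (intro tendsto_intros av_shift) (simp add: unit)
  moreover have "(1 / of_nat H) * (\<Sum>h<H. av (\<lambda>n. u (n + h)) k - av u k) = av v k - av u k" for k
    using Hpos unfolding v_def av_cmult av_sum by (simp add: sum_subtractf field_simps)
  ultimately have lim1: "(\<lambda>k. av v k - av u k) \<longlonglongrightarrow> 0" by simp
  have vv: "v n * cnj (v n) = (1 / (of_nat H)\<^sup>2) * (\<Sum>h<H. \<Sum>k<H. u (n + h) * cnj (u (n + k)))" for n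
    by (simp add: v_def sum_product power2_eq_square)
  have pair: "av (\<lambda>n. u (n + h) * cnj (u (n + k))) \<longlonglongrightarrow> (if h = k then 1 else 0)" for h k
  proof (cases "h = k")
    case True
    then show ?thesis using av_const[of 1] by (simp add: complex_norm_square[symmetric] unit)
  qed (simp add: corr)
  have "(\<lambda>k. (1 / (of_nat H)\<^sup>2) * (\<Sum>h<H. \<Sum>h'<H. av (\<lambda>n. u (n + h) * cnj (u (n + h'))) k))
      \<longlonglongrightarrow> (1 / (of_nat H)\<^sup>2) * (\<Sum>h<H. \<Sum>h'<H. (if h = h' then 1 else 0))"
    by (intro tendsto_intros pair)
  then have "(\<lambda>k. av (\<lambda>n. v n * cnj (v n)) k) \<longlonglongrightarrow> (1 / (of_nat H)\<^sup>2) * (\<Sum>h<H. \<Sum>h'<H. (if h = h' then 1 else 0))"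
    unfolding vv av_cmult av_sum .
  moreover have "(1 / (of_nat H)\<^sup>2) * (\<Sum>h<H. \<Sum>h'<H. (if h = h' then 1 else 0)) = (1 / of_nat H :: complex)"
    using Hpos by (simp add: power2_eq_square)
  ultimately have "(\<lambda>k. Re (av (\<lambda>n. v n * cnj (v n)) k)) \<longlonglongrightarrow> Re (1 / of_nat H)"
    by (intro tendsto_Re) simp
  moreover have "Re (1 / of_nat H) = 1 / real H"
    by (metis Re_complex_of_real of_real_1 of_real_divide of_real_of_nat_eq)
  moreover have "1 / real H < e\<^sup>2 / 4"
    using H e Hpos by (simp add: field_simps)
  ultimately have "\<forall>\<^sub>F k in sequentially. Re (av (\<lambda>n. v n * cnj (v n)) k) < e\<^sup>2 / 4"
    by (intro order_tendstoD(2)[where y = "1 / real H"]) simp_all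
  moreover have "\<forall>\<^sub>F k in sequentially. norm (av v k - av u k) < e / 2"
    using tendstoD[OF lim1 half_gt_zero[OF e]] unfolding dist_norm diff_0_right .
  ultimately have "\<forall>\<^sub>F k in sequentially. norm (av u k - 0) < e"
  proof eventually_elim
    case (elim k)
    have "(norm (av v k))\<^sup>2 < (e / 2)\<^sup>2"
      using norm_av_power2_le[of v k] elim(1) by (simp add: power_divide)
    then have "norm (av v k) < e / 2" by (rule power2_less_imp_less) (use e in simp)
    then show ?case
      using elim(2) norm_triangle_ineq4[of "av v k" "av v k - av u k"] by simp
  qed
  then show "\<exists>k0. \<forall>k\<ge>k0. norm (av u k - 0) < e"
    by (simp add: eventually_sequentially)
qed

text \<open>The weighted sum is a Riemann sum for the integral of \<open>cis (c * t)\<close>. A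
  correction of the order of the mesh turns each term into an exact increment of the primitive, so
  the corrected sums telescope.\<close>

lemma av_cis_linear:
  assumes "c \<noteq> 0"
  shows "av (\<lambda>n. cis (c * V n)) \<longlonglongrightarrow> 0"
proof -
  define d where "d = (\<lambda>n. cis (c * V (Suc n)) - cis (c * V n))"
  \<comment> \<open>Chosen so that \<open>fdiff V n * (cis (c * V n) + r n)\<close> equals
    \<open>d n / (\<i> * c)\<close>. Where the weight is 0, so is \<open>d n\<close>, and the
    default 0 is consistent.\<close>
  define r where "r = (\<lambda>n. if fdiff V n = 0 then 0 else d n / (\<i> * c * fdiff V n) - cis (c * V n))"
  have rd: "complex_of_real (fdiff V n) * (cis (c * V n) + r n) = d n / (\<i> * c)" for n
  proof (cases "fdiff V n = 0")
    case True
    then show ?thesis by (simp add: d_def fdiff_def)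
  next
    case False
    then have "cis (c * V n) + r n = d n / (\<i> * c * fdiff V n)" by (simp add: r_def)
    then show ?thesis using assms False by simp
  qed
  have r_bound: "norm (r n) \<le> \<bar>c\<bar> / 2 * fdiff V n" for n
  proof (cases "fdiff V n = 0")
    case False
    then have pos: "fdiff V n > 0" using w_nonneg[of n] by simp
    define y where "y = c * fdiff V n"
    have y: "c * V (Suc n) = c * V n + y" by (simp add: y_def fdiff_def algebra_simps)
    have yc: "complex_of_real c * complex_of_real (fdiff V n) = of_real y" by (simp add: y_def)
    \<comment> \<open>Up to a unimodular factor \<open>r n\<close> is the Taylor remainder of
      \<open>iexp y\<close> after the linear term, divided by \<open>y\<close>, hence of order
      \<open>fdiff V n\<close>.\<close>
    have "r n = cis (c * V n) * (iexp y - (1 + \<i> * y)) / (\<i> * y)"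
    proof -
      have "r n = (cis (c * V n) * iexp y - cis (c * V n)) / (\<i> * y) - cis (c * V n)"
        using False by (simp add: r_def d_def y mult.assoc yc flip: cis_conv_exp cis_mult)
      moreover have "y \<noteq> 0" using assms False by (simp add: y_def)
      ultimately show ?thesis by (simp add: field_simps)
    qed
    then have "norm (r n) = norm (iexp y - (1 + \<i> * y)) / \<bar>y\<bar>"
      by (simp add: norm_divide norm_mult)
    also have "\<dots> \<le> (\<bar>y\<bar>\<^sup>2 / 2) / \<bar>y\<bar>"
      using iexp_approx1[of y 1] by (intro divide_right_mono) (auto simp: numeral_2_eq_2)
    also have "\<dots> = \<bar>c\<bar> / 2 * fdiff V n"
      using pos by (simp add: power2_eq_square y_def abs_mult)
    finally show ?thesis .
  qed (simp add: r_def)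
  have "(\<lambda>n. \<bar>c\<bar> / 2 * fdiff V n) \<longlonglongrightarrow> 0"
    using tendsto_mult_left[OF w_null] by simp
  then have "r \<longlonglongrightarrow> 0"
    by (rule Lim_null_comparison[rotated]) (intro always_eventually allI r_bound)
  moreover have "av (\<lambda>n. cis (c * V n) + r n) \<longlonglongrightarrow> 0"
  proof (rule av_tendsto_zeroI)
    fix k
    have "norm (\<Sum>n=A k..<B k. d n) \<le> 2"
    proof (cases "A k \<le> B k")
      case True
      then have "(\<Sum>n=A k..<B k. d n) = cis (c * V (B k)) - cis (c * V (A k))"
        unfolding d_def by (rule sum_Suc_diff')
      then show ?thesis using norm_triangle_ineq4[of "cis (c * V (B k))" "cis (c * V (A k))"] by simp
    qed simp
    then show "norm (\<Sum>n=A k..<B k. complex_of_real (fdiff V n) * (cis (c * V n) + r n)) \<le> 2 / \<bar>c\<bar>"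
      unfolding rd using assms
      by (simp add: norm_divide norm_mult divide_right_mono flip: sum_divide_distrib)
  qed
  moreover have "(\<lambda>n. cis (c * V n) - (cis (c * V n) + r n)) \<longlonglongrightarrow> 0"
    using tendsto_minus[OF \<open>r \<longlonglongrightarrow> 0\<close>] by simp
  ultimately show ?thesis
    using av_cong_null[of "\<lambda>n. cis (c * V n)" "\<lambda>n. cis (c * V n) + r n"] by blast
qed

section \<open>Levels of functions relative to \<open>V\<close>\<close>

text \<open>
  Level 0 is the degenerate case that a combination of translates reaches when all its differences of
  order below the level of \<open>f\<close> cancel; with it the levels together are closed under such combinations.
\<close>

primrec tempered :: "nat \<Rightarrow> (nat \<Rightarrow> real) \<Rightarrow> bool" where
  "tempered 0 f \<longleftrightarrow> f \<longlonglongrightarrow> 0"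
| "tempered (Suc l) f \<longleftrightarrow> (\<exists>c. c \<noteq> 0 \<and> convergent (\<lambda>n. (fdiff ^^ l) f n - c * V n))"

lemma V_shift: "(\<lambda>n. V (n + i) - V n) \<longlonglongrightarrow> 0"
proof -
  have "(\<lambda>n. \<Sum>j<i. fdiff V (n + j)) \<longlonglongrightarrow> (\<Sum>j<i. 0)"
    by (intro tendsto_intros LIMSEQ_ignore_initial_segment w_null)
  then show ?thesis by (simp add: sum_fdiff_telescope)
qed

lemma shift_asymp:
  assumes "(\<lambda>n. g n - c * V n) \<longlonglongrightarrow> d"
  shows "(\<lambda>n. g (n + i) - c * V n) \<longlonglongrightarrow> d"
proof -
  have "(\<lambda>n. (g (n + i) - c * V (n + i)) + c * (V (n + i) - V n)) \<longlonglongrightarrow> d + c * 0"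
    by (intro tendsto_intros V_shift LIMSEQ_ignore_initial_segment[OF assms])
  then show ?thesis by (simp add: algebra_simps)
qed

lemma tempered_fdiff:
  assumes "tempered (Suc l) f"
  shows "tempered l (fdiff f)"
proof (cases l)
  case 0
  then obtain c d where c: "(\<lambda>n. f n - c * V n) \<longlonglongrightarrow> d"
    using assms by (auto simp: convergent_def)
  have "(\<lambda>n. (f (n + 1) - c * V n) - (f n - c * V n)) \<longlonglongrightarrow> d - d"
    by (intro tendsto_diff shift_asymp c)
  moreover have "fdiff f = (\<lambda>n. (f (n + 1) - c * V n) - (f n - c * V n))"
    by (simp add: fdiff_def fun_eq_iff)
  ultimately show ?thesis using 0 by simp
next
  case (Suc l')
  then show ?thesis using assms by (simp add: funpow_swap1)
qed

text \<open>If the coefficients have a nonzero sum, it multiplies the leading constant and the level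
  stays. If they sum to 0, summation by parts gives a combination of translates of
  \<open>fdiff f\<close>, one level lower, and induction applies.\<close>

lemma tempered_combination:
  assumes "tempered l f"
  shows "\<exists>l'. tempered l' (\<lambda>n. \<Sum>i<m. c i * f (n + i))"
  using assms
proof (induction l arbitrary: f c)
  case 0
  have "(\<lambda>n. \<Sum>i<m. c i * f (n + i)) \<longlonglongrightarrow> (\<Sum>i<m. c i * 0)"
    by (intro tendsto_intros LIMSEQ_ignore_initial_segment) (use 0 in simp)
  then have "tempered 0 (\<lambda>n. \<Sum>i<m. c i * f (n + i))" by simp
  then show ?case ..
next
  case (Suc l)
  show ?case
  proof (cases "(\<Sum>i<m. c i) = 0")
    case False
    obtain a d where a: "a \<noteq> 0" "(\<lambda>n. (fdiff ^^ l) f n - a * V n) \<longlonglongrightarrow> d"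
      using Suc.prems by (auto simp: convergent_def)
    have "(\<lambda>n. \<Sum>i<m. c i * ((fdiff ^^ l) f (n + i) - a * V n)) \<longlonglongrightarrow> (\<Sum>i<m. c i * d)"
      by (intro tendsto_intros shift_asymp a)
    then have "(\<lambda>n. (fdiff ^^ l) (\<lambda>n. \<Sum>i<m. c i * f (n + i)) n - (a * (\<Sum>i<m. c i)) * V n)
        \<longlonglongrightarrow> (\<Sum>i<m. c i * d)"
      by (simp add: fdiff_funpow_sum fdiff_funpow_cmult fdiff_funpow_shift right_diff_distrib
          sum_subtractf sum_distrib_left sum_distrib_right mult_ac)
    moreover have "a * (\<Sum>i<m. c i) \<noteq> 0" using a False by simp
    ultimately have "tempered (Suc l) (\<lambda>n. \<Sum>i<m. c i * f (n + i))"
      unfolding tempered.simps convergent_def by blast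
    then show ?thesis ..
  next
    case True
    \<comment> \<open>Telescoping \<open>f (n + i)\<close> down to \<open>f n\<close> leaves
      \<open>fdiff f (n + j)\<close> with the sum of the \<open>c i\<close> over all
      \<open>i > j\<close>.\<close>
    have "(\<Sum>i<m. c i * f (n + i)) = (\<Sum>j<m. (\<Sum>i\<in>{j<..<m}. c i) * fdiff f (n + j))" for n
    proof -
      have "(\<Sum>i<m. c i * f (n + i)) = (\<Sum>i<m. c i * f n + (\<Sum>j<i. c i * fdiff f (n + j)))"
        by (simp add: sum_fdiff_telescope right_diff_distrib flip: sum_distrib_left)
      also have "\<dots> = (\<Sum>i<m. \<Sum>j<i. c i * fdiff f (n + j))"
        using True by (simp add: sum.distrib flip: sum_distrib_right)
      also have "\<dots> = (\<Sum>j<m. \<Sum>i\<in>{j<..<m}. c i * fdiff f (n + j))"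
        unfolding sum.Sigma[OF finite_lessThan ballI[OF finite_lessThan]]
          sum.Sigma[OF finite_lessThan ballI[OF finite_greaterThanLessThan]]
        by (rule sum.reindex_bij_witness[of _ prod.swap prod.swap]) auto
      finally show ?thesis by (simp add: sum_distrib_right)
    qed
    then show ?thesis using Suc.IH[OF tempered_fdiff[OF Suc.prems]] by simp
  qed
qed

text \<open>A difference of two translates is a sum of first differences, so it trades one order of
  differencing for the leading constant \<open>c * (h - k)\<close>. This is nonzero, so van der
  Corput lowers the level by exactly one.\<close>

lemma tempered_correlation:
  assumes "tempered (Suc (Suc l)) f" "h \<noteq> k"
  shows "tempered (Suc l) (\<lambda>n. f (n + h) - f (n + k))"
proof -
  obtain c d where c: "c \<noteq> 0" "(\<lambda>n. (fdiff ^^ Suc l) f n - c * V n) \<longlonglongrightarrow> d"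
    using assms by (auto simp: convergent_def)
  define D where "D = (fdiff ^^ l) f"
  have D: "(\<lambda>n. fdiff D n - c * V n) \<longlonglongrightarrow> d" using c by (simp add: D_def)
  have *: "(\<lambda>n. D (n + i) - D n - (c * real i) * V n) \<longlonglongrightarrow> real i * d" for i
  proof -
    have "(\<lambda>n. \<Sum>j<i. (fdiff D (n + j) - c * V n)) \<longlonglongrightarrow> (\<Sum>j<i. d)"
      by (intro tendsto_intros shift_asymp D)
    then show ?thesis by (simp add: sum_subtractf sum_fdiff_telescope mult_ac)
  qed
  have "(\<lambda>n. (D (n + h) - D n - (c * real h) * V n) - (D (n + k) - D n - (c * real k) * V n))
      \<longlonglongrightarrow> real h * d - real k * d"
    by (intro tendsto_diff *)
  then have "(\<lambda>n. (fdiff ^^ l) (\<lambda>n. f (n + h) - f (n + k)) n - (c * (real h - real k)) * V n)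
      \<longlonglongrightarrow> real h * d - real k * d"
    by (simp add: fdiff_funpow_diff fdiff_funpow_shift D_def algebra_simps)
  moreover have "c * (real h - real k) \<noteq> 0" using c(1) assms(2) by simp
  ultimately show ?thesis unfolding tempered.simps convergent_def by blast
qed

lemma tempered_cmult:
  assumes "tempered (Suc l) f" "a \<noteq> 0"
  shows "tempered (Suc l) (\<lambda>n. a * f n)"
proof -
  obtain c d where c: "c \<noteq> 0" "(\<lambda>n. (fdiff ^^ l) f n - c * V n) \<longlonglongrightarrow> d"
    using assms by (auto simp: convergent_def)
  have "(\<lambda>n. (fdiff ^^ l) (\<lambda>n. a * f n) n - (a * c) * V n) \<longlonglongrightarrow> a * d"
    using tendsto_mult_left[OF c(2), of a] by (simp add: fdiff_funpow_cmult algebra_simps)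
  moreover have "a * c \<noteq> 0" using assms c by simp
  ultimately show ?thesis unfolding tempered.simps convergent_def by blast
qed

lemma tempered_diff_const:
  assumes "tempered (Suc l) f"
  shows "tempered (Suc l) (\<lambda>n. f n - a)"
proof (cases l)
  case 0
  then obtain c d where c: "c \<noteq> 0" "(\<lambda>n. f n - c * V n) \<longlonglongrightarrow> d"
    using assms by (auto simp: convergent_def)
  have "(\<lambda>n. f n - a - c * V n) \<longlonglongrightarrow> d - a"
    using tendsto_diff[OF c(2) tendsto_const[of a]] by (simp add: algebra_simps)
  then show ?thesis using c(1) 0 by (auto simp: convergent_def)
next
  case (Suc l')
  have "fdiff (\<lambda>n. f n - a) = fdiff f" by (simp add: fdiff_def fun_eq_iff)
  then show ?thesis using assms Suc by (simp add: funpow_swap1)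
qed

lemma tempered_shift:
  assumes "tempered (Suc l) f"
  shows "tempered (Suc l) (\<lambda>n. f (n + i))"
proof -
  obtain c d where c: "c \<noteq> 0" "(\<lambda>n. (fdiff ^^ l) f n - c * V n) \<longlonglongrightarrow> d"
    using assms by (auto simp: convergent_def)
  have "(\<lambda>n. (fdiff ^^ l) (\<lambda>n. f (n + i)) n - c * V n) \<longlonglongrightarrow> d"
    using shift_asymp[OF c(2)] by (simp add: fdiff_funpow_shift)
  then show ?thesis using c(1) by (auto simp: convergent_def)
qed

text \<open>Van der Corput descends to level 1, where \<open>f\<close> is \<open>c * V\<close> plus
  a constant up to a null sequence.\<close>

lemma av_cis_tempered:
  assumes "tempered (Suc l) f"
  shows "av (\<lambda>n. cis (f n)) \<longlonglongrightarrow> 0"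
  using assms
proof (induction l arbitrary: f)
  case 0
  then obtain c d where c: "c \<noteq> 0" "(\<lambda>n. f n - c * V n) \<longlonglongrightarrow> d"
    by (auto simp: convergent_def)
  have "(\<lambda>n. f n - c * V n - d) \<longlonglongrightarrow> 0" using c(2) by (simp add: LIM_zero)
  then have lim: "(\<lambda>n. \<bar>f n - c * V n - d\<bar>) \<longlonglongrightarrow> 0" by (rule tendsto_rabs_zero)
  have bound: "norm (cis (f n) - cis d * cis (c * V n)) \<le> \<bar>f n - c * V n - d\<bar>" for n
    using norm_cis_diff_le[of "f n" "d + c * V n"] by (simp add: cis_mult algebra_simps)
  have "(\<lambda>n. cis (f n) - cis d * cis (c * V n)) \<longlonglongrightarrow> 0"
    by (rule Lim_null_comparison[OF always_eventually lim]) (simp add: bound)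
  moreover have "av (\<lambda>n. cis d * cis (c * V n)) \<longlonglongrightarrow> 0"
    using tendsto_mult_left[OF av_cis_linear[OF c(1)], of "cis d"] by (simp add: av_cmult[abs_def])
  ultimately show ?case by (rule av_cong_null)
next
  case (Suc l)
  show ?case
  proof (rule van_der_corput)
    fix h k :: nat assume "h \<noteq> k"
    then show "av (\<lambda>n. cis (f (n + h)) * cnj (cis (f (n + k)))) \<longlonglongrightarrow> 0"
      using Suc.IH[OF tempered_correlation[OF Suc.prems]] by (simp add: cis_mult cis_cnj)
  qed simp
qed

lemma av_cis_dichotomy:
  assumes "tempered l f"
  shows "av (\<lambda>n. cis (f n)) \<longlonglongrightarrow> (if l = 0 then 1 else 0)"
proof (cases l)
  case 0
  have "(\<lambda>n. cis (f n) - 1) \<longlonglongrightarrow> 0"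
    by (rule Lim_null_comparison[of _ "\<lambda>n. \<bar>f n\<bar>"])
       (use norm_cis_diff_le[of _ 0] assms 0 in \<open>auto simp: tendsto_rabs_zero\<close>)
  then show ?thesis using av_cong_null[OF _ av_const] 0 by simp
next
  case (Suc l')
  then show ?thesis using assms av_cis_tempered by simp
qed

end

section \<open>Bohr sets and the continuous spectrum\<close>

lemma borel_measurable_cis [measurable (raw)]:
  assumes "f \<in> borel_measurable M"
  shows "(\<lambda>x. cis (f x)) \<in> borel_measurable M"
  using assms by (rule borel_measurable_continuous_on[rotated]) (intro continuous_intros)

text \<open>In an enumeration of the countably many atoms, the sets of atoms left after the first
  \<open>n\<close> decrease to the empty set; continuity from above applies.\<close>

lemma (in finite_measure) finite_atoms_approx:
  assumes "e > 0" and sets: "\<And>x. {x} \<in> sets M"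
  obtains F where "finite F" "F \<subseteq> {x. measure M {x} \<noteq> 0}" "measure M ({x. measure M {x} \<noteq> 0} - F) < e"
proof (cases "{x. measure M {x} \<noteq> 0} = {}")
  case True
  then show ?thesis using that[of "{}"] assms(1) by simp
next
  case False
  define At where "At = {x. measure M {x} \<noteq> 0}"
  have At: "countable At" "At \<noteq> {}" using countable_support False by (auto simp: At_def)
  define G where "G n = from_nat_into At ` {..<n}" for n :: nat
  have sub: "G n \<subseteq> At" for n using from_nat_into[OF At(2)] by (auto simp: G_def)
  have ctbl_sets: "X \<in> sets M" if "X \<subseteq> At" for X
    by (rule sets.countable[OF sets]) (use that At(1) countable_subset in auto)
  have "(\<lambda>n. measure M (At - G n)) \<longlonglongrightarrow> measure M (\<Inter>n. At - G n)"
    by (rule finite_Lim_measure_decseq) (auto simp: ctbl_sets G_def decseq_def)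
  also have "(\<Inter>n. At - G n) = {}"
  proof (rule equals0I)
    fix x assume x: "x \<in> (\<Inter>n. At - G n)"
    then obtain i where "x = from_nat_into At i"
      using from_nat_into_surj[OF At(1)] by (metis DiffD1 INT_iff UNIV_I)
    then have "x \<in> G (Suc i)" by (simp add: G_def)
    then show False using x by auto
  qed
  finally have "(\<lambda>n. measure M (At - G n)) \<longlonglongrightarrow> 0" by simp
  from order_tendstoD(2)[OF this assms(1)] obtain n where "measure M (At - G n) < e"
    by (auto simp: eventually_sequentially)
  then show ?thesis using that[of "G n"] sub[of n] by (auto simp: G_def At_def)
qed

section \<open>Weights concentrated on Bohr sets\<close>

context weighted_averages
begin

text \<open>
  The value \<open>s h\<close> is the Fourier coefficient of the weight \<open>u\<close> at \<open>- h\<close>; the number \<open>\<kappa>\<close> bounds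
  the mean of \<open>u\<close> from below.
\<close>

definition spectral_weight :: "(nat \<Rightarrow> real) set \<Rightarrow> real \<Rightarrow> (nat \<Rightarrow> real) \<Rightarrow> bool" where
  "spectral_weight H \<kappa> u \<longleftrightarrow> (\<exists>s. s (\<lambda>n. 0) \<ge> \<kappa> \<and>
     (\<forall>h\<in>H. s h \<ge> 0 \<and> av (\<lambda>n. complex_of_real (u n) * cis (h n)) \<longlonglongrightarrow> complex_of_real (s h)))"

lemma spectral_weight_one:
  assumes "\<And>h. h \<in> H \<Longrightarrow> \<exists>l. tempered l h"
  shows "spectral_weight H 1 (\<lambda>n. 1)"
proof -
  \<comment> \<open>Level 0 is tested first: a function tending to 0 has mean 1, and every other
    member of \<open>H\<close> has a positive level and mean 0.\<close>
  define s :: "(nat \<Rightarrow> real) \<Rightarrow> real" where "s h = (if tempered 0 h then 1 else 0)" for h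
  have "av (\<lambda>n. cis (h n)) \<longlonglongrightarrow> complex_of_real (s h)" if "h \<in> H" for h
  proof (cases "tempered 0 h")
    case True
    then show ?thesis using av_cis_dichotomy[OF True] by (simp add: s_def)
  next
    case False
    obtain l where l: "tempered l h" using assms[OF \<open>h \<in> H\<close>] ..
    with False have "l \<noteq> 0" by metis
    with av_cis_dichotomy[OF l] show ?thesis using False by (simp add: s_def)
  qed
  then show ?thesis unfolding spectral_weight_def
    by (intro exI[of _ s]) (auto simp: s_def)
qed

text \<open>The kernel is the squared modulus of \<open>(1 + cis g) / 2\<close>, so its power is a
  binomial sum times its conjugate, and all coefficients are nonnegative.\<close>

lemma cos_kernel_expansion:
  "complex_of_real (((1 + cos g) / 2) ^ K) =
     (\<Sum>j\<le>K. \<Sum>k\<le>K. complex_of_real (real (K choose j) / 2 ^ K * (real (K choose k) / 2 ^ K))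
        * cis ((real j - real k) * g))"
proof -
  have "complex_of_real ((1 + cos g) / 2) = ((cis g + 1) / 2) * ((cis (- g) + 1) / 2)"
    by (simp add: algebra_simps cis_mult add_divide_distrib complex_eq_iff)
  then have "complex_of_real (((1 + cos g) / 2) ^ K) = ((cis g + 1) ^ K / 2 ^ K) * ((cis (- g) + 1) ^ K / 2 ^ K)"
    unfolding of_real_power by (simp only: power_mult_distrib power_divide)
  also have "(cis g + 1) ^ K = (\<Sum>j\<le>K. of_nat (K choose j) * cis (real j * g))"
    by (simp only: binomial_ring Complex.DeMoivre power_one mult_1_right)
  also have "(cis (- g) + 1) ^ K = (\<Sum>k\<le>K. of_nat (K choose k) * cis (real k * (- g)))"
    by (simp only: binomial_ring Complex.DeMoivre power_one mult_1_right)
  also have "(\<Sum>j\<le>K. of_nat (K choose j) * cis (real j * g)) / 2 ^ K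
      * ((\<Sum>k\<le>K. of_nat (K choose k) * cis (real k * (- g))) / 2 ^ K) =
      (\<Sum>j\<le>K. \<Sum>k\<le>K. complex_of_real (real (K choose j) / 2 ^ K * (real (K choose k) / 2 ^ K))
        * cis ((real j - real k) * g))"
    unfolding sum_divide_distrib sum_product
  proof (intro sum.cong refl)
    fix j k
    have "cis ((real j - real k) * g) = cis (real j * g) * cis (real k * (- g))"
      by (simp add: cis_mult algebra_simps)
    then show "of_nat (K choose j) * cis (real j * g) / 2 ^ K * (of_nat (K choose k) * cis (real k * (- g)) / 2 ^ K)
      = complex_of_real (real (K choose j) / 2 ^ K * (real (K choose k) / 2 ^ K)) * cis ((real j - real k) * g)"
      by simp
  qed
  finally show ?thesis .
qed

text \<open>Multiplication by the kernel convolves the Fourier coefficients with nonnegative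
  numbers, so nonnegativity is inherited whatever linear relations hold between the
  frequencies.\<close>

lemma spectral_weight_cos_kernel:
  assumes u: "spectral_weight H \<kappa> u" and "\<kappa> \<ge> 0" and g: "g \<in> H"
    and add: "\<And>h h'. h \<in> H \<Longrightarrow> h' \<in> H \<Longrightarrow> (\<lambda>n. h n + h' n) \<in> H"
    and scale: "\<And>h x. h \<in> H \<Longrightarrow> (\<lambda>n. x * h n) \<in> H"
  shows "spectral_weight H (\<kappa> / (real K + 1)) (\<lambda>n. u n * ((1 + cos (g n)) / 2) ^ K)"
proof -
  obtain s where s0: "s (\<lambda>n. 0) \<ge> \<kappa>" and s: "\<And>h. h \<in> H \<Longrightarrow> s h \<ge> 0"
    "\<And>h. h \<in> H \<Longrightarrow> av (\<lambda>n. complex_of_real (u n) * cis (h n)) \<longlonglongrightarrow> complex_of_real (s h)"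
    using u unfolding spectral_weight_def by blast
  define b where "b j = real (K choose j) / 2 ^ K" for j
  define t where "t h = (\<Sum>j\<le>K. \<Sum>k\<le>K. b j * b k * s (\<lambda>n. h n + (real j - real k) * g n))" for h
  have inH: "(\<lambda>n. h n + x * g n) \<in> H" if "h \<in> H" for h x
    using add[OF that scale[OF g]] .
  have b_nonneg: "b j \<ge> 0" for j by (simp add: b_def)
  have expand: "complex_of_real (u n * ((1 + cos (g n)) / 2) ^ K) * cis (h n) =
     (\<Sum>j\<le>K. \<Sum>k\<le>K. complex_of_real (b j * b k) *
        (complex_of_real (u n) * cis (h n + (real j - real k) * g n)))" for n h
    unfolding of_real_mult[of "u n"] cos_kernel_expansion b_def[symmetric] sum_distrib_left sum_distrib_right
    by (intro sum.cong refl) (simp add: cis_mult[symmetric] mult_ac)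
  have "av (\<lambda>n. complex_of_real (u n * ((1 + cos (g n)) / 2) ^ K) * cis (h n)) \<longlonglongrightarrow> complex_of_real (t h)"
    if "h \<in> H" for h
  proof -
    have "(\<lambda>i. \<Sum>j\<le>K. \<Sum>k\<le>K. complex_of_real (b j * b k) *
        av (\<lambda>n. complex_of_real (u n) * cis (h n + (real j - real k) * g n)) i)
       \<longlonglongrightarrow> (\<Sum>j\<le>K. \<Sum>k\<le>K. complex_of_real (b j * b k) * complex_of_real (s (\<lambda>n. h n + (real j - real k) * g n)))"
      by (intro tendsto_intros s inH that)
    then show ?thesis
      unfolding expand av_sum[abs_def] av_cmult[abs_def] t_def by simp
  qed
  moreover have "t h \<ge> 0" if "h \<in> H" for h
    unfolding t_def by (intro sum_nonneg mult_nonneg_nonneg b_nonneg s inH that)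
  \<comment> \<open>Only the diagonal \<open>j = k\<close>, which has frequency 0, is kept. The
    \<open>b j\<close> sum to 1, so by Cauchy-Schwarz their squares sum to at least
    \<open>1 / (K + 1)\<close>.\<close>
  moreover have "t (\<lambda>n. 0) \<ge> \<kappa> / (real K + 1)"
  proof -
    have "(\<Sum>j\<le>K. b j) = 1"
      by (simp add: b_def flip: sum_divide_distrib of_nat_sum) (simp add: choose_row_sum)
    then have "1 \<le> (\<Sum>j\<le>K. (b j)\<^sup>2) * (real K + 1)"
      using sum_squared_le_sum_of_squares[of b "{..K}"] by (simp add: add.commute)
    then have "\<kappa> / (real K + 1) \<le> \<kappa> * (\<Sum>j\<le>K. (b j)\<^sup>2)"
      using \<open>\<kappa> \<ge> 0\<close> by (simp add: divide_le_eq mult.assoc mult_le_cancel_left1)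
    also have "\<dots> = (\<Sum>j\<le>K. b j * b j * \<kappa>)"
      by (simp add: sum_distrib_left power2_eq_square mult_ac)
    also have "\<dots> \<le> (\<Sum>j\<le>K. \<Sum>k\<in>{j}. b j * b k * s (\<lambda>n. 0 + (real j - real k) * g n))"
      by (rule sum_mono) (simp add: mult_left_mono s0)
    also have "\<dots> \<le> (\<Sum>j\<le>K. \<Sum>k\<le>K. b j * b k * s (\<lambda>n. 0 + (real j - real k) * g n))"
      by (intro sum_mono sum_mono2 mult_nonneg_nonneg b_nonneg) (auto intro!: s scale g)
    finally show ?thesis by (simp add: t_def)
  qed
  ultimately show ?thesis unfolding spectral_weight_def by blast
qed

text \<open>A set of frequencies closed under addition and scaling, as the kernels require, whose
  members are all tempered when \<open>f\<close> is.\<close>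

definition translates_span :: "nat \<Rightarrow> (nat \<Rightarrow> real) \<Rightarrow> (nat \<Rightarrow> real) set" where
  "translates_span m f = {h. \<exists>c. h = (\<lambda>n. \<Sum>i<m. c i * f (n + i))}"

lemma translates_spanI: "h = (\<lambda>n. \<Sum>i<m. c i * f (n + i)) \<Longrightarrow> h \<in> translates_span m f"
  unfolding translates_span_def by blast

lemma translates_span_add:
  assumes "h \<in> translates_span m f" "h' \<in> translates_span m f"
  shows "(\<lambda>n. h n + h' n) \<in> translates_span m f"
proof -
  obtain c c' where "h = (\<lambda>n. \<Sum>i<m. c i * f (n + i))" "h' = (\<lambda>n. \<Sum>i<m. c' i * f (n + i))"
    using assms unfolding translates_span_def by blast
  then show ?thesis
    by (intro translates_spanI[of _ "\<lambda>i. c i + c' i"]) (simp add: sum.distrib distrib_right)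
qed

lemma translates_span_scale:
  assumes "h \<in> translates_span m f"
  shows "(\<lambda>n. x * h n) \<in> translates_span m f"
proof -
  obtain c where "h = (\<lambda>n. \<Sum>i<m. c i * f (n + i))"
    using assms unfolding translates_span_def by blast
  then show ?thesis
    by (intro translates_spanI[of _ "\<lambda>i. x * c i"]) (simp add: sum_distrib_left mult.assoc)
qed

lemma translates_span_base:
  assumes "i < m"
  shows "(\<lambda>n. x * f (n + i)) \<in> translates_span m f"
proof (rule translates_spanI[of _ "\<lambda>j. if j = i then x else 0"])
  have "(\<Sum>j<m. (if j = i then x else 0) * f (n + j)) = (\<Sum>j<m. if j = i then x * f (n + i) else 0)" for n
    by (rule sum.cong) auto
  then show "(\<lambda>n. x * f (n + i)) = (\<lambda>n. \<Sum>j<m. (if j = i then x else 0) * f (n + j))"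
    using assms by simp
qed

lemma spectral_weight_cos_kernels:
  assumes f: "tempered l f" and "finite D" "D \<subseteq> translates_span m f"
  shows "spectral_weight (translates_span m f) ((1 / (real K + 1)) ^ card D)
           (\<lambda>n. \<Prod>g\<in>D. ((1 + cos (g n)) / 2) ^ K)"
  using assms(2,3)
proof (induction D rule: finite_induct)
  case empty
  have "\<exists>l. tempered l h" if "h \<in> translates_span m f" for h
    using that tempered_combination[OF f] by (auto simp: translates_span_def)
  from spectral_weight_one[OF this] show ?case by simp
next
  case (insert g D)
  have "spectral_weight (translates_span m f) ((1 / (real K + 1)) ^ card D / (real K + 1))
      (\<lambda>n. (\<Prod>g\<in>D. ((1 + cos (g n)) / 2) ^ K) * ((1 + cos (g n)) / 2) ^ K)"
    by (rule spectral_weight_cos_kernel[OF _ _ _ translates_span_add translates_span_scale])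
       (use insert in auto)
  then show ?case using insert(1,2) by (simp add: mult.commute)
qed

text \<open>The mean of the kernel product is at least a fixed negative power of
  \<open>K + 1\<close>, whereas outside the Bohr set the product is at most \<open>q ^ K\<close>.
  For large \<open>K\<close> the exponential is smaller, and it serves as
  \<open>\<kappa>\<close>.\<close>

lemma bohr_weight:
  assumes f: "tempered l f" and D: "finite D" "D \<subseteq> translates_span m f" and e: "e > 0" "e < 1"
  obtains \<Phi> \<kappa> L where "0 < \<kappa>" "\<kappa> < L" "\<And>n. \<Phi> n \<le> 1"
    "av (\<lambda>n. complex_of_real (\<Phi> n)) \<longlonglongrightarrow> complex_of_real L"
    "\<And>n g. \<Phi> n > \<kappa> \<Longrightarrow> g \<in> D \<Longrightarrow> cos (g n) > 1 - e"
proof -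
  define q where "q = 1 - e / 2"
  have q: "0 < q" "q < 1" using e by (auto simp: q_def)
  have "(\<lambda>K. (real K + 1) ^ card D * q ^ K) \<longlonglongrightarrow> 0"
    using q by real_asymp
  from order_tendstoD(2)[OF this zero_less_one] obtain K where K: "(real K + 1) ^ card D * q ^ K < 1"
    by (auto simp: eventually_sequentially)
  define \<Phi> where "\<Phi> n = (\<Prod>g\<in>D. ((1 + cos (g n)) / 2) ^ K)" for n
  have range: "0 \<le> ((1 + cos x) / 2) ^ K" "((1 + cos x) / 2) ^ K \<le> 1" for x :: real
  proof -
    have "0 \<le> (1 + cos x) / 2" "(1 + cos x) / 2 \<le> 1"
      using cos_ge_minus_one[of x] cos_le_one[of x] by (simp_all del: cos_ge_minus_one cos_le_one)
    then show "0 \<le> ((1 + cos x) / 2) ^ K" "((1 + cos x) / 2) ^ K \<le> 1" by (simp_all add: power_le_one)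
  qed
  obtain s where s: "s (\<lambda>n. 0) \<ge> (1 / (real K + 1)) ^ card D"
    "\<And>h. h \<in> translates_span m f \<Longrightarrow> av (\<lambda>n. complex_of_real (\<Phi> n) * cis (h n)) \<longlonglongrightarrow> complex_of_real (s h)"
    using spectral_weight_cos_kernels[OF f D, of K] unfolding spectral_weight_def \<Phi>_def by blast
  have "(\<lambda>n. 0) \<in> translates_span m f"
    unfolding translates_span_def by (auto intro!: exI[of _ "\<lambda>_. 0"])
  from s(2)[OF this] have lim: "av (\<lambda>n. complex_of_real (\<Phi> n)) \<longlonglongrightarrow> complex_of_real (s (\<lambda>n. 0))" by simp
  have "q ^ K < (1 / (real K + 1)) ^ card D"
    using K by (simp add: power_one_over field_simps)
  then have "q ^ K < s (\<lambda>n. 0)" using s(1) by simp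
  moreover have "cos (g n) > 1 - e" if n: "\<Phi> n > q ^ K" and g: "g \<in> D" for n g
  proof -
    have "\<Phi> n = ((1 + cos (g n)) / 2) ^ K * (\<Prod>g\<in>D - {g}. ((1 + cos (g n)) / 2) ^ K)"
      unfolding \<Phi>_def by (rule prod.remove[OF D(1) g])
    also have "\<dots> \<le> ((1 + cos (g n)) / 2) ^ K * 1"
      by (intro mult_left_mono prod_le_1 conjI range)
    finally have "q ^ K < ((1 + cos (g n)) / 2) ^ K" using n by simp
    moreover have "0 \<le> (1 + cos (g n)) / 2"
      using cos_ge_minus_one[of "g n"] by (simp del: cos_ge_minus_one)
    ultimately have "q < (1 + cos (g n)) / 2" by (rule power_less_imp_less_base)
    then show ?thesis by (simp add: q_def field_simps)
  qed
  moreover have "\<Phi> n \<le> 1" for n unfolding \<Phi>_def by (intro prod_le_1 conjI range)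
  ultimately show thesis using that[OF _ _ _ lim, of "q ^ K"] q by auto
qed

section \<open>Wiener's lemma for the continuous part\<close>

lemma av_integral:
  assumes "\<And>n. integrable N (F n)"
  shows "av (\<lambda>n. LINT y|N. F n y) k = (LINT y|N. av (\<lambda>n. F n y) k)"
proof -
  have "(LINT y|N. av (\<lambda>n. F n y) k)
      = (LINT y|N. (\<Sum>n=A k..<B k. complex_of_real (fdiff V n) * F n y)) / complex_of_real (mass k)"
    unfolding av_def by (rule integral_divide_zero)
  also have "(LINT y|N. (\<Sum>n=A k..<B k. complex_of_real (fdiff V n) * F n y))
      = (\<Sum>n=A k..<B k. complex_of_real (fdiff V n) * (LINT y|N. F n y))"
    by (subst Bochner_Integration.integral_sum) (auto intro: assms)
  finally show ?thesis unfolding av_def by (rule sym)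
qed

text \<open>As a double integral over \<open>C\<close>, the squared modulus involves
  \<open>cis ((x - y) * g n)\<close>, whose average tends to 0 off the diagonal; the diagonal is
  null because \<open>C\<close> contains no atom. Dominated convergence is applied first in
  \<open>y\<close> for fixed \<open>x\<close>, then in \<open>x\<close>.\<close>

lemma wiener:
  assumes \<nu>: "real_distribution \<nu>" and C: "C \<in> sets borel" "\<And>x. x \<in> C \<Longrightarrow> measure \<nu> {x} = 0"
    and g: "tempered (Suc l) g"
  defines "\<rho> \<equiv> \<lambda>t. LINT x|\<nu>. indicator C x * cis (x * t)"
  shows "av (\<lambda>n. complex_of_real ((norm (\<rho> (g n)))\<^sup>2)) \<longlonglongrightarrow> 0"
proof -
  interpret real_distribution \<nu> by fact
  note [measurable] = C(1)
  have nrm: "norm (indicator C x * cis (x * t) :: complex) \<le> 1" for x t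
    by (simp add: norm_mult indicator_def)
  have int: "integrable \<nu> (\<lambda>x. indicator C x * cis (x * t))" for t
    by (rule integrable_const_bound[of _ 1]) (auto intro: nrm)
  have \<rho>_le: "norm (\<rho> t) \<le> 1" for t
  proof -
    have "norm (\<rho> t) \<le> (LINT x|\<nu>. 1)"
      unfolding \<rho>_def by (rule Bochner_Integration.integral_norm_bound_integral) (auto intro: int nrm)
    also have "\<dots> = 1" using prob_space by simp
    finally show ?thesis .
  qed
  \<comment> \<open>The averaged integrand in \<open>x\<close>; the integral over \<open>y\<close>
    is still hidden in \<open>\<rho>\<close>.\<close>
  define G where "G x k = av (\<lambda>n. cis (x * g n) * cnj (\<rho> (g n))) k" for x k
  have G_le: "norm (G x k) \<le> 1" for x k
    unfolding G_def by (rule norm_av_le) (simp_all add: norm_mult \<rho>_le)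
  have G_meas [measurable]: "(\<lambda>x. G x k) \<in> borel_measurable borel" for k
    unfolding G_def av_def by measurable
  have G_lim: "G x \<longlonglongrightarrow> 0" if x: "x \<in> C" for x
  proof -
    define E where "E y k = av (\<lambda>n. cis ((x - y) * g n)) k" for y k
    have E_le: "norm (E y k) \<le> 1" for y k
      unfolding E_def by (rule norm_av_le) simp_all
    have E_meas [measurable]: "(\<lambda>y. E y k) \<in> borel_measurable borel" for k
      unfolding E_def av_def by measurable
    have "cis (x * g n) * cnj (\<rho> (g n)) = (LINT y|\<nu>. indicator C y * cis ((x - y) * g n))" for n
    proof -
      have "cnj (\<rho> (g n)) = (LINT y|\<nu>. cnj (indicator C y * cis (y * g n)))"
        unfolding \<rho>_def by (rule integral_bounded_linear[OF bounded_linear_cnj int, symmetric])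
      then have "cis (x * g n) * cnj (\<rho> (g n)) = (LINT y|\<nu>. cis (x * g n) * cnj (indicator C y * cis (y * g n)))"
        by (simp only: integral_mult_right_zero)
      also have "\<dots> = (LINT y|\<nu>. indicator C y * cis ((x - y) * g n))"
        by (intro Bochner_Integration.integral_cong refl)
           (simp add: indicator_def cis_cnj cis_mult left_diff_distrib)
      finally show ?thesis .
    qed
    then have "G x k = av (\<lambda>n. LINT y|\<nu>. indicator C y * cis ((x - y) * g n)) k" for k
      unfolding G_def by presburger
    also have "av (\<lambda>n. LINT y|\<nu>. indicator C y * cis ((x - y) * g n)) k
        = (LINT y|\<nu>. av (\<lambda>n. indicator C y * cis ((x - y) * g n)) k)" for k
      by (rule av_integral, rule integrable_const_bound[of _ 1]) (auto simp: norm_mult indicator_def)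
    finally have "G x k = (LINT y|\<nu>. av (\<lambda>n. indicator C y * cis ((x - y) * g n)) k)" for k .
    then have "G x = (\<lambda>k. LINT y|\<nu>. indicator C y * E y k)"
      by (simp add: fun_eq_iff av_cmult E_def)
    moreover have "(\<lambda>k. LINT y|\<nu>. indicator C y * E y k) \<longlonglongrightarrow> (LINT y|\<nu>. 0)"
    proof (rule integral_dominated_convergence[where w = "\<lambda>_. 1"])
      \<comment> \<open>For \<open>y \<noteq> x\<close> the function \<open>(x - y) * g n\<close>
        keeps its positive level; the excluded point is not an atom since
        \<open>x \<in> C\<close>.\<close>
      have "AE y in \<nu>. y \<notin> {x}"
        by (rule AE_not_in) (use C(2)[OF x] in \<open>simp add: null_sets_def emeasure_eq_measure\<close>)
      then show "AE y in \<nu>. (\<lambda>k. indicator C y * E y k) \<longlonglongrightarrow> 0"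
      proof eventually_elim
        case (elim y)
        then have "tempered (Suc l) (\<lambda>n. (x - y) * g n)" by (intro tempered_cmult[OF g]) simp
        then have "E y \<longlonglongrightarrow> 0" unfolding E_def[abs_def] by (rule av_cis_tempered)
        from tendsto_mult_left[OF this] show ?case by simp
      qed
    qed (auto simp: norm_mult E_le indicator_def)
    ultimately show ?thesis by (simp only: Bochner_Integration.integral_zero)
  qed
  have square: "complex_of_real ((norm (\<rho> t))\<^sup>2) = (LINT x|\<nu>. indicator C x * (cis (x * t) * cnj (\<rho> t)))" for t
  proof -
    have "complex_of_real ((norm (\<rho> t))\<^sup>2) = (LINT x|\<nu>. indicator C x * cis (x * t)) * cnj (\<rho> t)"
      unfolding complex_norm_square by (simp only: \<rho>_def)
    also have "\<dots> = (LINT x|\<nu>. indicator C x * cis (x * t) * cnj (\<rho> t))"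
      by (rule integral_mult_left_zero[symmetric])
    finally show ?thesis by (simp only: mult.assoc)
  qed
  have "av (\<lambda>n. complex_of_real ((norm (\<rho> (g n)))\<^sup>2)) k
      = av (\<lambda>n. LINT x|\<nu>. indicator C x * (cis (x * g n) * cnj (\<rho> (g n)))) k" for k
    by (rule arg_cong[where f = "\<lambda>u. av u k"], rule ext, rule square)
  also have "av (\<lambda>n. LINT x|\<nu>. indicator C x * (cis (x * g n) * cnj (\<rho> (g n)))) k
      = (LINT x|\<nu>. av (\<lambda>n. indicator C x * (cis (x * g n) * cnj (\<rho> (g n)))) k)" for k
    by (rule av_integral, rule integrable_const_bound[of _ 1]) (auto simp: norm_mult indicator_def \<rho>_le)
  finally have "av (\<lambda>n. complex_of_real ((norm (\<rho> (g n)))\<^sup>2)) k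
      = (LINT x|\<nu>. av (\<lambda>n. indicator C x * (cis (x * g n) * cnj (\<rho> (g n)))) k)" for k .
  then have "av (\<lambda>n. complex_of_real ((norm (\<rho> (g n)))\<^sup>2)) = (\<lambda>k. LINT x|\<nu>. indicator C x * G x k)"
    by (simp add: fun_eq_iff av_cmult G_def)
  moreover have "(\<lambda>k. LINT x|\<nu>. indicator C x * G x k) \<longlonglongrightarrow> (LINT x|\<nu>. 0)"
  proof (rule integral_dominated_convergence[where w = "\<lambda>_. 1"])
    show "AE x in \<nu>. (\<lambda>k. indicator C x * G x k) \<longlonglongrightarrow> 0"
      using G_lim by (auto simp: indicator_def)
  qed (auto simp: norm_mult G_le indicator_def)
  ultimately show ?thesis by (simp only: Bochner_Integration.integral_zero)
qed

end

section \<open>Density of simultaneous returns\<close>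

lemma cos_near_one_imp_near_int:
  assumes "0 < \<delta>" "\<delta> < 1 / 2" "cos (2 * pi * t) > cos (2 * pi * \<delta>)"
  shows "\<bar>t - of_int (round t)\<bar> < \<delta>"
proof (rule ccontr)
  define d where "d = \<bar>t - of_int (round t)\<bar>"
  assume "\<not> \<bar>t - of_int (round t)\<bar> < \<delta>"
  then have d: "\<delta> \<le> d" "d \<le> 1 / 2"
    using of_int_round_abs_le[of t] by (auto simp: d_def abs_minus_commute)
  have "cos (2 * pi * t) = cos (2 * pi * (t - of_int (round t)) + (2 * pi) * of_int (round t))"
    by (simp add: algebra_simps)
  also have "\<dots> = cos (2 * pi * (t - of_int (round t)))"
    unfolding cos_add cos_int_2pin sin_int_2pin by simp
  also have "\<dots> = cos (2 * pi * d)"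
  proof -
    have "\<bar>2 * pi * (t - of_int (round t))\<bar> = 2 * pi * d" by (simp add: d_def abs_mult)
    then show ?thesis by (metis cos_abs_real)
  qed
  also have "\<dots> \<le> cos (2 * pi * \<delta>)"
    using assms d by (intro cos_monotone_0_pi_le) (auto simp: field_simps)
  finally show False using assms by simp
qed

text \<open>The reason for the shift by \<open>1 / 2\<close>: a half-integer is as far as possible
  from the jumps of the floor.\<close>

lemma floor_half_shift:
  fixes t :: real
  assumes "\<bar>t - 1 / 2 - of_int k\<bar> < 1 / 2"
  shows "\<lfloor>t\<rfloor> = k"
  using assms by (intro floor_unique) linarith+

lemma abs_cos_diff_le: "\<bar>cos a - cos b\<bar> \<le> \<bar>a - b\<bar>" for a b :: real
  using abs_Re_le_cmod[of "cis a - cis b"] norm_cis_diff_le[of a b] by simp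

text \<open>The chosen atoms contribute nonnegatively, the remaining atoms cost at most their mass,
  and off the atoms the integral is the real part of the transform in \<open>cont\<close>.\<close>

lemma integral_cos_lower_bound:
  assumes "real_distribution \<nu>"
    and F: "finite F" "F \<subseteq> At" and At: "countable At"
    and pos: "\<And>x. x \<in> F \<Longrightarrow> cos (x * t) \<ge> 0"
    and tail: "measure \<nu> (At - F) \<le> a"
    and cont: "norm (LINT x|\<nu>. indicator (- At) x * cis (x * t)) \<le> b"
  shows "(LINT x|\<nu>. cos (x * t)) \<ge> - a - b"
proof -
  interpret real_distribution \<nu> by fact
  have [measurable]: "At \<in> sets borel" "F \<in> sets borel"
    using At F by (auto intro: sets.countable countable_finite)
  have int: "integrable \<nu> (\<lambda>x. indicator X x * cos (x * t) :: real)" if "X \<in> sets borel" for X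
    using that by (intro integrable_const_bound[of _ 1]) (auto simp: indicator_def)
  have "(LINT x|\<nu>. cos (x * t)) = (LINT x|\<nu>. indicator F x * cos (x * t)
      + indicator (At - F) x * cos (x * t) + indicator (- At) x * cos (x * t))"
    using F by (intro Bochner_Integration.integral_cong refl) (auto simp: indicator_def)
  also have "\<dots> = (LINT x|\<nu>. indicator F x * cos (x * t)) + (LINT x|\<nu>. indicator (At - F) x * cos (x * t))
      + (LINT x|\<nu>. indicator (- At) x * cos (x * t))"
    by (simp add: int Bochner_Integration.integral_add)
  also have "\<dots> \<ge> 0 + - a + - b"
  proof (intro add_mono)
    show "0 \<le> (LINT x|\<nu>. indicator F x * cos (x * t))"
      using pos by (intro Bochner_Integration.integral_nonneg) (auto simp: indicator_def)
    have "- a \<le> (LINT x|\<nu>. - indicator (At - F) x)"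
      using tail by simp
    also have "\<dots> \<le> (LINT x|\<nu>. indicator (At - F) x * cos (x * t))"
    proof (rule integral_mono)
      show "integrable \<nu> (\<lambda>x. - indicator (At - F) x :: real)"
        by (intro integrable_const_bound[of _ 1]) (auto simp: indicator_def)
      show "integrable \<nu> (\<lambda>x. indicator (At - F) x * cos (x * t))" by (rule int) simp
    qed (auto simp: indicator_def)
    finally show "- a \<le> (LINT x|\<nu>. indicator (At - F) x * cos (x * t))" .
    have intc: "integrable \<nu> (\<lambda>x. indicator (- At) x * cis (x * t))"
      by (intro integrable_const_bound[of _ 1]) (auto simp: indicator_def)
    have "(LINT x|\<nu>. indicator (- At) x * cos (x * t)) = (LINT x|\<nu>. Re (indicator (- At) x * cis (x * t)))"
      by (intro Bochner_Integration.integral_cong refl) (auto simp: indicator_def)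
    also have "\<dots> = Re (LINT x|\<nu>. indicator (- At) x * cis (x * t))"
      by (rule integral_bounded_linear[OF bounded_linear_Re intc])
    finally show "- b \<le> (LINT x|\<nu>. indicator (- At) x * cos (x * t))"
      using cont abs_Re_le_cmod[of "LINT x|\<nu>. indicator (- At) x * cis (x * t)"] by linarith
  qed
  finally show ?thesis by simp
qed

context weighted_averages
begin

text \<open>The indicator of the good set is bounded below by a function whose average has a
  positive limit. All \<open>m\<close> consecutive times are handled at once, by putting all
  translates into a single Bohr weight.\<close>

lemma returns_positive_lower_density:
  assumes \<nu>: "real_distribution \<nu>" and supp: "AE x in \<nu>. 0 \<le> x \<and> x \<le> 2 * pi"
    and f: "tempered (Suc l) f" and e: "e > 0"
  shows "\<exists>\<eta>>0. \<forall>\<^sub>F k in sequentially. \<eta> * mass k \<le>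
    (\<Sum>n\<in>{A k..<B k} \<inter> {n. \<forall>i<m. (LINT x|\<nu>. cos (x * real_of_int \<lfloor>f (n + i)\<rfloor>)) > - e}. fdiff V n)"
proof -
  interpret real_distribution \<nu> by fact
  define g where "g n = f n - 1 / 2" for n
  have g: "tempered (Suc l) g" unfolding g_def[abs_def] by (rule tempered_diff_const[OF f])
  define At where "At = {x. measure \<nu> {x} \<noteq> 0}"
  have At: "countable At" unfolding At_def by (rule countable_support)
  obtain F where F: "finite F" "F \<subseteq> At" "measure \<nu> (At - F) < e / 4"
    using finite_atoms_approx[of "e / 4"] e unfolding At_def by auto
  define \<rho> where "\<rho> t = (LINT x|\<nu>. indicator (- At) x * cis (x * t))" for t
  \<comment> \<open>The bound \<open>1 / 4\<close> keeps the floor determined;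
    \<open>e / (16 * pi)\<close> makes rounding \<open>g\<close> to an integer cost at most
    \<open>e / 8\<close> for \<open>x\<close> in \<open>[0, 2 * pi]\<close>.\<close>
  define \<delta> where "\<delta> = min (1 / 4) (e / (16 * pi))"
  have \<delta>: "0 < \<delta>" "\<delta> \<le> 1 / 4" "2 * pi * \<delta> < e / 4"
  proof -
    have "2 * pi * \<delta> \<le> 2 * pi * (e / (16 * pi))" unfolding \<delta>_def by (intro mult_left_mono) auto
    also have "\<dots> < e / 4" using e by simp
    finally show "2 * pi * \<delta> < e / 4" .
  qed (use e in \<open>auto simp: \<delta>_def\<close>)
  \<comment> \<open>A cosine above \<open>1 - \<theta>\<close> is positive, as wanted at the atoms,
    and exceeds \<open>cos (2 * pi * \<delta>)\<close>, which at frequency \<open>2 * pi\<close>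
    puts \<open>g\<close> within \<open>\<delta>\<close> of an integer.\<close>
  define \<theta> where "\<theta> = min (1 / 2) ((1 - cos (2 * pi * \<delta>)) / 2)"
  have "cos (2 * pi * \<delta>) < cos 0" using \<delta> by (intro cos_monotone_0_pi) (auto simp: field_simps)
  then have \<theta>: "0 < \<theta>" "\<theta> < 1" "1 - \<theta> > cos (2 * pi * \<delta>)"
    by (auto simp: \<theta>_def min_def field_simps)
  define D where "D = (\<lambda>(x, i) n. x * g (n + i)) ` (insert (2 * pi) F \<times> {..<m})"
  have D: "finite D" "D \<subseteq> translates_span m g"
    using F(1) translates_span_base by (auto simp: D_def)
  obtain \<Phi> \<kappa> L where \<Phi>: "0 < \<kappa>" "\<kappa> < L" "\<And>n. \<Phi> n \<le> 1"
    "av (\<lambda>n. complex_of_real (\<Phi> n)) \<longlonglongrightarrow> complex_of_real L"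
    "\<And>n h. \<Phi> n > \<kappa> \<Longrightarrow> h \<in> D \<Longrightarrow> cos (h n) > 1 - \<theta>"
    by (rule bohr_weight[OF g D \<theta>(1,2)], rule that, assumption+)
  \<comment> \<open>The factor \<open>16 / e\<^sup>2\<close> makes a summand reach 1 once the
    continuous part reaches \<open>e / 4\<close>. As \<open>\<Phi> n - \<kappa> < 1\<close>,
    positivity of \<open>Z n\<close> forces both \<open>\<Phi> n > \<kappa>\<close> and small
    continuous parts; by Wiener the sum has mean 0 in the limit.\<close>
  define Z where "Z n = \<Phi> n - \<kappa> - (\<Sum>i<m. (16 / e\<^sup>2) * (norm (\<rho> (g (n + i))))\<^sup>2)" for n
  have good: "\<forall>i<m. (LINT x|\<nu>. cos (x * real_of_int \<lfloor>f (n + i)\<rfloor>)) > - e" if Z: "Z n > 0" for n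
  proof (intro allI impI)
    fix i assume i: "i < m"
    have nonneg: "(\<Sum>i<m. (16 / e\<^sup>2) * (norm (\<rho> (g (n + i))))\<^sup>2) \<ge> 0"
      by (intro sum_nonneg) auto
    then have "\<Phi> n > \<kappa>" using Z by (simp add: Z_def)
    have cosD: "cos (x * g (n + i)) > 1 - \<theta>" if "x \<in> insert (2 * pi) F" for x
    proof -
      have "(\<lambda>n. x * g (n + i)) \<in> D" unfolding D_def using that i by (intro image_eqI[of _ _ "(x, i)"]) auto
      from \<Phi>(5)[OF \<open>\<Phi> n > \<kappa>\<close> this] show ?thesis .
    qed
    have "(16 / e\<^sup>2) * (norm (\<rho> (g (n + i))))\<^sup>2 \<le> (\<Sum>i<m. (16 / e\<^sup>2) * (norm (\<rho> (g (n + i))))\<^sup>2)"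
      using i by (intro member_le_sum) auto
    also have "\<dots> < 1" using Z \<Phi>(1) \<Phi>(3)[of n] by (simp add: Z_def)
    finally have "(norm (\<rho> (g (n + i))))\<^sup>2 < (e / 4)\<^sup>2"
      using e by (simp add: field_simps power2_eq_square)
    then have \<rho>: "norm (\<rho> (g (n + i))) < e / 4"
      by (rule power2_less_imp_less) (use e in simp)
    have lower: "(LINT x|\<nu>. cos (x * g (n + i))) \<ge> - (e / 4) - e / 4"
    proof (rule integral_cos_lower_bound[OF \<nu> F(1,2) At])
      show "cos (x * g (n + i)) \<ge> 0" if "x \<in> F" for x
        using cosD[of x] that \<theta> by simp
    qed (use F(3) \<rho> in \<open>auto simp: \<rho>_def\<close>)
    define k where "k = round (g (n + i))"
    have k: "\<bar>g (n + i) - of_int k\<bar> < \<delta>"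
      unfolding k_def using cosD[of "2 * pi"] \<theta>(3) \<delta>
      by (intro cos_near_one_imp_near_int) (auto simp: mult_ac)
    then have "\<lfloor>f (n + i)\<rfloor> = k" using \<delta> by (intro floor_half_shift) (auto simp: g_def)
    \<comment> \<open>On the support \<open>x\<close> is at most \<open>2 * pi\<close>, so replacing
      \<open>g (n + i)\<close> by \<open>k\<close> costs less than \<open>e / 4\<close>, on top of
      the \<open>e / 2\<close> already lost.\<close>
    have "\<bar>(LINT x|\<nu>. cos (x * g (n + i))) - (LINT x|\<nu>. cos (x * of_int k))\<bar>
        = \<bar>LINT x|\<nu>. cos (x * g (n + i)) - cos (x * of_int k)\<bar>"
      by (subst Bochner_Integration.integral_diff) (auto intro!: integrable_const_bound[of _ 1])
    also have "\<dots> \<le> (LINT x|\<nu>. \<bar>cos (x * g (n + i)) - cos (x * of_int k)\<bar>)"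
      by (rule integral_abs_bound)
    also have "\<dots> \<le> (LINT x|\<nu>. 2 * pi * \<delta>)"
    proof (rule integral_mono_AE)
      show "AE x in \<nu>. \<bar>cos (x * g (n + i)) - cos (x * of_int k)\<bar> \<le> 2 * pi * \<delta>"
        using supp
      proof eventually_elim
        case (elim x)
        have "\<bar>cos (x * g (n + i)) - cos (x * of_int k)\<bar> \<le> \<bar>x\<bar> * \<bar>g (n + i) - of_int k\<bar>"
          using abs_cos_diff_le[of "x * g (n + i)" "x * of_int k"]
          by (simp add: abs_mult flip: right_diff_distrib)
        also have "\<dots> \<le> 2 * pi * \<delta>" using elim k by (intro mult_mono) auto
        finally show ?case .
      qed
      show "integrable \<nu> (\<lambda>x. \<bar>cos (x * g (n + i)) - cos (x * of_int k)\<bar>)"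
        by (intro integrable_abs Bochner_Integration.integrable_diff integrable_const_bound[of _ 1]) auto
    qed simp
    also have "\<dots> = 2 * pi * \<delta>" using prob_space by simp
    finally show "(LINT x|\<nu>. cos (x * real_of_int \<lfloor>f (n + i)\<rfloor>)) > - e"
      using lower \<delta>(3) e unfolding \<open>\<lfloor>f (n + i)\<rfloor> = k\<close> by linarith
  qed
  have Z_le: "Z n \<le> 1" for n
  proof -
    have "(\<Sum>i<m. (16 / e\<^sup>2) * (norm (\<rho> (g (n + i))))\<^sup>2) \<ge> 0" by (intro sum_nonneg) auto
    then show ?thesis using \<Phi>(1) \<Phi>(3)[of n] by (simp add: Z_def)
  qed
  have \<rho>_lim: "av (\<lambda>n. complex_of_real ((norm (\<rho> (g (n + i))))\<^sup>2)) \<longlonglongrightarrow> 0" for i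
    unfolding \<rho>_def
  proof (rule wiener[OF \<nu> _ _ tempered_shift[OF g]])
    have "At \<in> sets borel" by (rule sets.countable[OF _ At]) simp
    then show "- At \<in> sets borel" by (rule borel_comp)
  qed (simp add: At_def)
  have "(\<lambda>k. av (\<lambda>n. complex_of_real (\<Phi> n)) k - av (\<lambda>n. complex_of_real \<kappa>) k
      - (\<Sum>i<m. complex_of_real (16 / e\<^sup>2) * av (\<lambda>n. complex_of_real ((norm (\<rho> (g (n + i))))\<^sup>2)) k))
    \<longlonglongrightarrow> complex_of_real L - complex_of_real \<kappa> - (\<Sum>i<m. complex_of_real (16 / e\<^sup>2) * 0)"
    by (intro tendsto_intros \<Phi> av_const \<rho>_lim)
  moreover have "av (\<lambda>n. complex_of_real (\<Phi> n)) k - av (\<lambda>n. complex_of_real \<kappa>) k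
      - (\<Sum>i<m. complex_of_real (16 / e\<^sup>2) * av (\<lambda>n. complex_of_real ((norm (\<rho> (g (n + i))))\<^sup>2)) k)
      = complex_of_real ((\<Sum>n=A k..<B k. fdiff V n * Z n) / mass k)" for k
    unfolding av_of_real[symmetric] av_cmult[symmetric] av_sum[symmetric] av_diff[symmetric]
    by (simp add: Z_def)
  ultimately have "(\<lambda>k. complex_of_real ((\<Sum>n=A k..<B k. fdiff V n * Z n) / mass k)) \<longlonglongrightarrow> complex_of_real (L - \<kappa>)"
    by simp
  then have "(\<lambda>k. (\<Sum>n=A k..<B k. fdiff V n * Z n) / mass k) \<longlonglongrightarrow> L - \<kappa>"
    by (simp only: tendsto_of_real_iff)
  then have "\<forall>\<^sub>F k in sequentially. (\<Sum>n=A k..<B k. fdiff V n * Z n) / mass k > (L - \<kappa>) / 2"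
    by (rule order_tendstoD) (use \<Phi>(2) in simp)
  with eventually_mass_pos have "\<forall>\<^sub>F k in sequentially. (L - \<kappa>) / 2 * mass k \<le>
    (\<Sum>n\<in>{A k..<B k} \<inter> {n. \<forall>i<m. (LINT x|\<nu>. cos (x * real_of_int \<lfloor>f (n + i)\<rfloor>)) > - e}. fdiff V n)"
    (is "\<forall>\<^sub>F k in _. _ \<le> sum _ (_ \<inter> ?G)")
  proof eventually_elim
    case (elim k)
    have "(L - \<kappa>) / 2 * mass k \<le> (\<Sum>n=A k..<B k. fdiff V n * Z n)"
      using elim by (simp add: field_simps)
    \<comment> \<open>\<open>Z\<close> is at most 1 everywhere and nonpositive outside the good
      set.\<close>
    also have "\<dots> \<le> (\<Sum>n=A k..<B k. if n \<in> ?G then fdiff V n else 0)"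
    proof (rule sum_mono)
      fix n
      show "fdiff V n * Z n \<le> (if n \<in> ?G then fdiff V n else 0)"
      proof (cases "n \<in> ?G")
        case True
        then show ?thesis using mult_left_mono[OF Z_le w_nonneg, of n n] by simp
      next
        case False
        have "Z n \<le> 0"
        proof (rule ccontr)
          assume "\<not> Z n \<le> 0"
          then have "n \<in> ?G" by (intro CollectI good) (rule not_le[THEN iffD1])
          with False show False ..
        qed
        then show ?thesis unfolding if_not_P[OF False] by (rule mult_nonneg_nonpos[OF w_nonneg])
      qed
    qed
    also have "\<dots> = sum (fdiff V) ({A k..<B k} \<inter> ?G)"
      by (rule sum.inter_restrict[symmetric]) simp
    finally show ?case .
  qed
  then show ?thesis using \<Phi>(2) by (intro exI[of _ "(L - \<kappa>) / 2"]) simp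
qed

end

section \<open>Herglotz's theorem and the spectral measure of a set\<close>

lemma has_bochner_integral_cos:
  fixes i :: int
  shows "has_bochner_integral lborel (\<lambda>x. cos (of_int i * x) * indicator {0..2 * pi} x)
    (if i = 0 then 2 * pi else 0)"
proof (cases "i = 0")
  case True
  have "has_bochner_integral lborel (\<lambda>x. 1 * indicator {0..2 * pi} x) (2 * pi - 0 :: real)"
    by (rule has_bochner_integral_FTC_Icc_real) (auto intro!: derivative_eq_intros)
  then show ?thesis using True by simp
next
  case False
  have "has_bochner_integral lborel (\<lambda>x. cos (of_int i * x) * indicator {0..2 * pi} x)
     (sin (of_int i * (2 * pi)) / of_int i - sin (of_int i * 0) / of_int i)"
    by (rule has_bochner_integral_FTC_Icc_real) (use False in \<open>auto intro!: derivative_eq_intros\<close>)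
  moreover have "sin (real_of_int i * (2 * pi)) = 0"
    using sin_int_2pin[of i] by (simp add: mult_ac)
  ultimately show ?thesis using False by simp
qed

lemma sum_diagonal_shift:
  "(\<Sum>j<N. \<Sum>k<N. if int j - int k = int m then c else (0::real)) = real (N - m) * c"
proof -
  have "(\<Sum>k<N. if int j - int k = int m then c else 0) = (if m \<le> j then c else 0)" if "j < N" for j
  proof -
    have "(\<Sum>k<N. if int j - int k = int m then c else 0) = (\<Sum>k<N. if k = j - m \<and> m \<le> j then c else 0)"
      by (rule sum.cong) (auto intro!: arg_cong[of _ _ "\<lambda>b. if b then c else 0"])
    also have "\<dots> = (if m \<le> j then c else 0)"
      using that by (cases "m \<le> j") (auto simp: sum.delta)
    finally show ?thesis .
  qed
  then have "(\<Sum>j<N. \<Sum>k<N. if int j - int k = int m then c else 0) = (\<Sum>j<N. if m \<le> j then c else 0)"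
    by simp
  also have "\<dots> = (\<Sum>j\<in>{m..<N}. c)"
    by (rule sum.mono_neutral_cong_right) auto
  finally show ?thesis by simp
qed

text \<open>\<open>p N\<close> is a Fejer mean of the Fourier series of \<open>b\<close> on one
  period, nonnegative by positive definiteness. Its coefficients are \<open>b m\<close> times a
  factor tending to 1, so a weak limit of these densities has the coefficients
  \<open>b m\<close>.\<close>

lemma herglotz:
  fixes b :: "nat \<Rightarrow> real"
  assumes b0: "b 0 = 1"
    and pos_def: "\<And>N x. 0 \<le> (\<Sum>j<N. \<Sum>k<N. b (nat \<bar>int j - int k\<bar>) * cos (of_int (int j - int k) * x))"
  obtains \<nu> where "real_distribution \<nu>" "AE x in \<nu>. 0 \<le> x \<and> x \<le> 2 * pi"
    "\<And>m. (LINT x|\<nu>. cos (x * real m)) = b m"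
proof -
  define p :: "nat \<Rightarrow> real \<Rightarrow> real" where "p N x = (\<Sum>j<N. \<Sum>k<N. b (nat \<bar>int j - int k\<bar>) * cos (of_int (int j - int k) * x)) / (2 * pi * real N)
     * indicator {0..2 * pi} x" for N x
  have p_nonneg: "p N x \<ge> 0" for N x
    unfolding p_def by (intro mult_nonneg_nonneg divide_nonneg_nonneg pos_def) auto
  have p_meas [measurable]: "p N \<in> borel_measurable borel" for N
    unfolding p_def[abs_def] by measurable
  have p_coeff: "has_bochner_integral lborel (\<lambda>x. p N x * cos (x * real m)) (real (N - m) / real N * b m)" for N m
  proof -
    \<comment> \<open>Half of the normalisation \<open>1 / (2 * pi * N)\<close>; the factor 2
      returns through the product-to-sum formula.\<close>
    define c where "c i = b (nat \<bar>i\<bar>) / (4 * pi * real N)" for i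
    have "has_bochner_integral lborel
      (\<lambda>x. \<Sum>j<N. \<Sum>k<N. c (int j - int k) * (cos (of_int (int j - int k + int m) * x) * indicator {0..2 * pi} x
         + cos (of_int (int j - int k - int m) * x) * indicator {0..2 * pi} x))
      (\<Sum>j<N. \<Sum>k<N. c (int j - int k) * ((if int j - int k + int m = 0 then 2 * pi else 0)
         + (if int j - int k - int m = 0 then 2 * pi else 0)))"
      by (intro has_bochner_integral_sum has_bochner_integral_mult_right has_bochner_integral_add
          has_bochner_integral_cos)
    moreover have "(\<Sum>j<N. \<Sum>k<N. c (int j - int k) * (cos (of_int (int j - int k + int m) * x) * indicator {0..2 * pi} x
         + cos (of_int (int j - int k - int m) * x) * indicator {0..2 * pi} x)) = p N x * cos (x * real m)" for x
    proof -
      have prod_to_sum: "cos (of_int (i + int m) * x) + cos (of_int (i - int m) * x) = 2 * (cos (of_int i * x) * cos (x * real m))" for i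
        using cos_add[of "of_int i * x" "x * real m"] cos_diff[of "of_int i * x" "x * real m"]
        by (simp add: algebra_simps)
      have "c i * (cos (of_int (i + int m) * x) * indicator {0..2 * pi} x
          + cos (of_int (i - int m) * x) * indicator {0..2 * pi} x)
        = b (nat \<bar>i\<bar>) * cos (of_int i * x) / (2 * pi * real N) * indicator {0..2 * pi} x * cos (x * real m)" for i
        unfolding distrib_right[symmetric] prod_to_sum c_def by (simp add: mult_ac)
      then show ?thesis
        unfolding p_def sum_divide_distrib sum_distrib_right by (intro sum.cong refl) blast
    qed
    moreover have "(\<Sum>j<N. \<Sum>k<N. c (int j - int k) * ((if int j - int k + int m = 0 then 2 * pi else 0)
         + (if int j - int k - int m = 0 then 2 * pi else 0))) = real (N - m) / real N * b m"
    proof -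
      have "(\<Sum>j<N. \<Sum>k<N. c (int j - int k) * ((if int j - int k + int m = 0 then 2 * pi else 0)
         + (if int j - int k - int m = 0 then 2 * pi else 0)))
        = (\<Sum>j<N. \<Sum>k<N. if int k - int j = int m then c (int m) * (2 * pi) else 0)
        + (\<Sum>j<N. \<Sum>k<N. if int j - int k = int m then c (int m) * (2 * pi) else 0)"
        unfolding sum.distrib[symmetric]
      proof (intro sum.cong refl)
        fix j k
        have "c (int j - int k) = c (int m)" if "int k - int j = int m"
          using that by (simp add: c_def abs_minus_commute[of "int j"])
        moreover have "int j - int k + int m = 0 \<longleftrightarrow> int k - int j = int m" "int j - int k - int m = 0 \<longleftrightarrow> int j - int k = int m"
          by auto
        ultimately show "c (int j - int k) * ((if int j - int k + int m = 0 then 2 * pi else 0)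
           + (if int j - int k - int m = 0 then 2 * pi else 0))
          = (if int k - int j = int m then c (int m) * (2 * pi) else 0)
           + (if int j - int k = int m then c (int m) * (2 * pi) else 0)"
          by (auto simp: distrib_left)
      qed
      also have "(\<Sum>j<N. \<Sum>k<N. if int k - int j = int m then c (int m) * (2 * pi) else 0)
        = (\<Sum>j<N. \<Sum>k<N. if int j - int k = int m then c (int m) * (2 * pi) else 0)"
        by (rule sum.swap)
      finally show ?thesis
        unfolding sum_diagonal_shift by (simp add: c_def field_simps)
    qed
    ultimately show ?thesis by simp
  qed
  \<comment> \<open>The index \<open>Suc N\<close> skips \<open>p 0\<close>, which vanishes
    identically.\<close>
  define \<mu> where "\<mu> N = density lborel (\<lambda>x. ennreal (p (Suc N) x))" for N
  have \<mu>_dist: "real_distribution (\<mu> N)" for N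
  proof -
    have "has_bochner_integral lborel (p (Suc N)) 1"
      using p_coeff[of "Suc N" 0] b0 by simp
    then have "(\<integral>\<^sup>+x. ennreal (p (Suc N) x) \<partial>lborel) = 1"
      by (subst nn_integral_eq_integral) (auto simp: has_bochner_integral_iff p_nonneg)
    then have "emeasure (\<mu> N) (space (\<mu> N)) = 1"
      by (simp add: \<mu>_def emeasure_density)
    then show ?thesis
      by (intro real_distribution.intro prob_spaceI real_distribution_axioms.intro) (auto simp: \<mu>_def)
  qed
  have \<mu>_supp: "AE x in \<mu> N. 0 \<le> x \<and> x \<le> 2 * pi" for N
    unfolding \<mu>_def by (subst AE_density) (auto simp: p_def indicator_def)
  have \<mu>_int: "(LINT x|\<mu> N. cos (x * real m)) = real (Suc N - m) / real (Suc N) * b m" for N m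
  proof -
    have "(LINT x|\<mu> N. cos (x * real m)) = (LINT x|lborel. p (Suc N) x *\<^sub>R cos (x * real m))"
      unfolding \<mu>_def by (rule integral_density) (auto simp: p_nonneg)
    also have "\<dots> = real (Suc N - m) / real (Suc N) * b m"
      using has_bochner_integral_integral_eq[OF p_coeff[of "Suc N" m]] by simp
    finally show ?thesis .
  qed
  have "tight \<mu>"
    unfolding tight_def
  proof (intro conjI allI impI \<mu>_dist)
    fix \<epsilon> :: real assume "\<epsilon> > 0"
    have "measure (\<mu> n) {-1<..2 * pi} > 1 - \<epsilon>" for n
    proof -
      interpret real_distribution "\<mu> n" by (rule \<mu>_dist)
      have "measure (\<mu> n) {-1<..2 * pi} = 1"
        by (rule prob_eq_1[THEN iffD2]) (use \<mu>_supp[of n] in \<open>auto elim: eventually_mono\<close>)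
      then show ?thesis using \<open>\<epsilon> > 0\<close> by simp
    qed
    then show "\<exists>a b. a < b \<and> (\<forall>n. measure (\<mu> n) {a<..b} > 1 - \<epsilon>)"
      by (intro exI[of _ "-1"] exI[of _ "2 * pi"]) (auto intro: less_trans[of _ 0])
  qed
  then obtain r \<nu> where r: "strict_mono r" and \<nu>: "real_distribution \<nu>" and conv: "weak_conv_m (\<mu> \<circ> r) \<nu>"
    using tight_imp_convergent_subsubsequence[of \<mu> id] by (auto simp: strict_mono_def)
  interpret \<nu>: real_distribution \<nu> by fact
  have lim: "(\<lambda>n. LINT x|\<mu> (r n). f x) \<longlonglongrightarrow> (LINT x|\<nu>. f x)"
    if "\<And>x. isCont f x" "\<And>x. norm (f x) \<le> 1" for f :: "real \<Rightarrow> real"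
    using weak_conv_imp_integral_bdd_continuous_conv[OF _ \<nu> conv that] \<mu>_dist by (simp add: o_def)
  have coeff: "(LINT x|\<nu>. cos (x * real m)) = b m" for m
  proof -
    have "(\<lambda>n. real (Suc n - m) / real (Suc n) * b m) \<longlonglongrightarrow> 1 * b m"
    proof (intro tendsto_intros)
      have "(\<lambda>n. 1 - real m * inverse (real (Suc n))) \<longlonglongrightarrow> 1 - real m * 0"
        by (intro tendsto_intros LIMSEQ_inverse_real_of_nat)
      moreover have "\<forall>\<^sub>F n in sequentially. 1 - real m * inverse (real (Suc n)) = real (Suc n - m) / real (Suc n)"
        using eventually_ge_at_top[of m]
        by eventually_elim (simp add: of_nat_diff field_simps del: of_nat_Suc)
      ultimately show "(\<lambda>n. real (Suc n - m) / real (Suc n)) \<longlonglongrightarrow> 1"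
        by (simp add: tendsto_cong del: of_nat_Suc)
    qed
    from LIMSEQ_subseq_LIMSEQ[OF this r]
    have "(\<lambda>n. LINT x|\<mu> (r n). cos (x * real m)) \<longlonglongrightarrow> b m"
      by (simp add: \<mu>_int o_def)
    moreover have "(\<lambda>n. LINT x|\<mu> (r n). cos (x * real m)) \<longlonglongrightarrow> (LINT x|\<nu>. cos (x * real m))"
      by (rule lim) auto
    ultimately show ?thesis by (rule LIMSEQ_unique[THEN sym])
  qed
  \<comment> \<open>A bounded continuous function vanishing exactly on \<open>[0, 2 * pi]\<close>:
    weak convergence carries its integral 0 over to \<open>\<nu>\<close>, which confines the limit
    to the interval.\<close>
  define d :: "real \<Rightarrow> real" where "d x = min 1 (max 0 (max (- x) (x - 2 * pi)))" for x
  have d_cont: "isCont d x" for x unfolding d_def[abs_def] by (intro continuous_intros)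
  have d: "norm (d x) \<le> 1" "d x \<ge> 0" "d x = 0 \<longleftrightarrow> 0 \<le> x \<and> x \<le> 2 * pi" for x
    unfolding d_def[abs_def] by (auto simp: min_def max_def)
  have [measurable]: "d \<in> borel_measurable borel"
    by (intro borel_measurable_continuous_onI continuous_at_imp_continuous_on ballI d_cont)
  have "(LINT x|\<mu> n. d x) = 0" for n
    by (rule integral_eq_zero_AE) (use \<mu>_supp[of n] d(3) in \<open>auto elim: eventually_mono\<close>)
  with lim[OF d_cont d(1)] have "(LINT x|\<nu>. d x) = 0"
    by (simp add: LIMSEQ_const_iff)
  moreover have "integrable \<nu> d"
    by (rule \<nu>.integrable_const_bound[of _ 1]) (use d(1) in auto)
  ultimately have "AE x in \<nu>. d x = 0"
    using integral_nonneg_eq_0_iff_AE[of \<nu> d] d(2) by simp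
  then have "AE x in \<nu>. 0 \<le> x \<and> x \<le> 2 * pi"
    by (simp only: d(3))
  from that[OF \<nu> this coeff] show thesis .
qed

section \<open>Correlations of a set under the iterates of \<open>T\<close>\<close>

context invertible_pmp_system
begin

lemma funpow_T_measurable [measurable]: "T ^^ m \<in> measurable M M"
proof (induction m)
  case (Suc m)
  then show ?case using measurable_comp[OF Suc T_measurable] by (simp only: funpow.simps)
qed (simp add: id_def)

lemma funpow_T_space: "x \<in> space M \<Longrightarrow> (T ^^ m) x \<in> space M"
  using funpow_T_measurable by (rule measurable_space)

lemma measure_funpow_T_vimage:
  assumes "B \<in> sets M"
  shows "measure M ((T ^^ m) -` B \<inter> space M) = measure M B"
proof (induction m)
  case (Suc m)
  have "(T ^^ Suc m) -` B \<inter> space M = T -` ((T ^^ m) -` B \<inter> space M) \<inter> space M"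
    using measurable_space[OF T_measurable] by (auto simp: funpow_swap1)
  then show ?case
    using Suc T_preserving[OF measurable_sets[OF funpow_T_measurable assms]] by metis
next
  case 0
  show ?case using sets.sets_into_space[OF assms] by (simp add: Int_absorb2)
qed

lemma inverse_funpow_T:
  assumes "x \<in> space M"
  shows "((inv_into (space M) T) ^^ n) ((T ^^ n) x) = x"
proof (induction n)
  case (Suc n)
  have "(inv_into (space M) T ^^ Suc n) ((T ^^ Suc n) x)
      = (inv_into (space M) T ^^ n) (inv_into (space M) T (T ((T ^^ n) x)))"
    by (simp add: funpow_swap1)
  also have "inv_into (space M) T (T ((T ^^ n) x)) = (T ^^ n) x"
    using T_bij funpow_T_space[OF assms] by (intro inv_into_f_f) (auto simp: bij_betw_def)
  finally show ?case using Suc by simp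
qed simp

text \<open>For \<open>k = - n\<close> the measure preserving \<open>T ^^ n\<close> pulls the
  intersection back to the one for \<open>n\<close>: the backward iterate cancels and
  \<open>A\<close> becomes a preimage. So only the modulus of \<open>k\<close> matters.\<close>

lemma measure_int_iterate:
  assumes A: "A \<in> sets M"
  shows "measure M (A \<inter> (int_iterate (space M) T k -` A \<inter> space M))
    = measure M (A \<inter> ((T ^^ nat \<bar>k\<bar>) -` A \<inter> space M))"
proof (cases "k \<ge> 0")
  case False
  define n where "n = nat (- k)"
  define S where "S = inv_into (space M) T"
  have S: "S ^^ i \<in> measurable M M" for i
  proof (induction i)
    case (Suc i)
    then show ?case using measurable_comp[OF Suc T_inv_measurable] by (simp only: funpow.simps S_def)
  qed (simp add: id_def)
  have "(T ^^ n) -` (A \<inter> ((S ^^ n) -` A \<inter> space M)) \<inter> space M = A \<inter> ((T ^^ n) -` A \<inter> space M)"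
    using inverse_funpow_T[of _ n] sets.sets_into_space[OF A] funpow_T_space by (auto simp: S_def)
  then have "measure M (A \<inter> ((S ^^ n) -` A \<inter> space M)) = measure M (A \<inter> ((T ^^ n) -` A \<inter> space M))"
    using measure_funpow_T_vimage[of "A \<inter> ((S ^^ n) -` A \<inter> space M)" n] A measurable_sets[OF S A] by auto
  then show ?thesis using False by (simp add: int_iterate_def n_def S_def)
qed (simp add: int_iterate_def)

lemma measure_correlation:
  assumes A: "A \<in> sets M"
  shows "measure M (((T ^^ j) -` A \<inter> space M) \<inter> ((T ^^ k) -` A \<inter> space M))
    = measure M (A \<inter> ((T ^^ nat \<bar>int j - int k\<bar>) -` A \<inter> space M))"
proof -
  have *: "measure M (((T ^^ j) -` A \<inter> space M) \<inter> ((T ^^ (j + d)) -` A \<inter> space M))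
    = measure M (A \<inter> ((T ^^ d) -` A \<inter> space M))" for j d
  proof -
    have "((T ^^ j) -` A \<inter> space M) \<inter> ((T ^^ (j + d)) -` A \<inter> space M)
      = (T ^^ j) -` (A \<inter> ((T ^^ d) -` A \<inter> space M)) \<inter> space M"
      using funpow_T_space by (auto simp: funpow_add add.commute[of j d])
    then show ?thesis
      using measure_funpow_T_vimage[of "A \<inter> ((T ^^ d) -` A \<inter> space M)" j]
        A measurable_sets[OF funpow_T_measurable A] by auto
  qed
  show ?thesis
  proof (cases "j \<le> k")
    case True
    then show ?thesis using *[of j "k - j"] by (simp add: abs_minus_commute of_nat_diff nat_diff_distrib)
  next
    case False
    then show ?thesis using *[of k "j - k"] by (simp add: Int_commute nat_diff_distrib)
  qed
qed

text \<open>Correlation minus squared measure is the autocovariance of the centred indicator of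
  \<open>A\<close>, hence positive definite, and Herglotz applies. The value at 0 gets altered,
  hence the restriction to \<open>m > 0\<close>.\<close>

lemma spectral_measure:
  assumes A: "A \<in> sets M"
  obtains \<nu> where "real_distribution \<nu>" "AE x in \<nu>. 0 \<le> x \<and> x \<le> 2 * pi"
    "\<And>m. m > 0 \<Longrightarrow> measure M (A \<inter> ((T ^^ m) -` A \<inter> space M)) = (measure M A)\<^sup>2 + (LINT x|\<nu>. cos (x * real m))"
proof -
  define \<alpha> where "\<alpha> = measure M A"
  define r where "r m = measure M (A \<inter> ((T ^^ m) -` A \<inter> space M)) - \<alpha>\<^sup>2" for m
  \<comment> \<open>Raising the diagonal to 1 keeps the sequence positive definite and makes \<open>\<nu>\<close> a probability measure.\<close>
  define b where "b m = (if m = 0 then 1 else r m)" for m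
  define Y where "Y j = (T ^^ j) -` A \<inter> space M" for j
  have Y [measurable]: "Y j \<in> sets M" for j
    unfolding Y_def by (rule measurable_sets[OF funpow_T_measurable A])
  define \<psi> :: "nat \<Rightarrow> 'a \<Rightarrow> real" where "\<psi> j w = indicator (Y j) w - \<alpha>" for j w
  have \<alpha>: "0 \<le> \<alpha>" "\<alpha> \<le> 1" by (auto simp: \<alpha>_def)
  have Y_measure: "measure M (Y j) = \<alpha>" for j
    unfolding Y_def \<alpha>_def by (rule measure_funpow_T_vimage[OF A])
  have intI: "integrable M (\<lambda>w. indicator X w :: real)" if "X \<in> sets M" for X
    using that by (intro integrable_real_indicator) (auto simp: emeasure_eq_measure)
  have prod_eq: "\<psi> j w * \<psi> k w = indicator (Y j \<inter> Y k) w - \<alpha> * indicator (Y j) w - \<alpha> * indicator (Y k) w + \<alpha>\<^sup>2" for j k w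
    by (simp add: \<psi>_def indicator_inter_arith algebra_simps power2_eq_square)
  have prod_int: "integrable M (\<lambda>w. \<psi> j w * \<psi> k w)" for j k
    unfolding prod_eq by (intro Bochner_Integration.integrable_add Bochner_Integration.integrable_diff
        integrable_mult_right intI) auto
  have prod_integral: "(LINT w|M. \<psi> j w * \<psi> k w) = r (nat \<bar>int j - int k\<bar>)" for j k
  proof -
    have "(LINT w|M. \<psi> j w * \<psi> k w) = measure M (Y j \<inter> Y k) - \<alpha> * measure M (Y j) - \<alpha> * measure M (Y k) + \<alpha>\<^sup>2"
      unfolding prod_eq using prob_space
      by (simp add: intI Bochner_Integration.integral_add Bochner_Integration.integral_diff)
    then show ?thesis
      using measure_correlation[OF A, of j k] by (simp add: Y_measure r_def Y_def[symmetric] power2_eq_square)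
  qed
  have pos_def: "0 \<le> (\<Sum>j<N. \<Sum>k<N. r (nat \<bar>int j - int k\<bar>) * cos (of_int (int j - int k) * x))" for N x
  proof -
    have "(\<Sum>j<N. \<Sum>k<N. r (nat \<bar>int j - int k\<bar>) * cos (of_int (int j - int k) * x))
        = (LINT w|M. (\<Sum>j<N. \<Sum>k<N. \<psi> j w * \<psi> k w * cos (of_int (int j - int k) * x)))"
      by (simp add: prod_integral prod_int Bochner_Integration.integral_sum)
    \<comment> \<open>For each \<open>w\<close> the double sum is the squared modulus of the sum of
      \<open>\<psi> j w * cis (real j * x)\<close>, in real terms.\<close>
    also have "\<dots> = (LINT w|M. (\<Sum>j<N. \<psi> j w * cos (real j * x))\<^sup>2 + (\<Sum>j<N. \<psi> j w * sin (real j * x))\<^sup>2)"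
    proof (intro Bochner_Integration.integral_cong refl)
      fix w
      have "\<psi> j w * \<psi> k w * cos (of_int (int j - int k) * x)
          = (\<psi> j w * cos (real j * x)) * (\<psi> k w * cos (real k * x))
          + (\<psi> j w * sin (real j * x)) * (\<psi> k w * sin (real k * x))" for j k
        by (simp add: left_diff_distrib cos_diff algebra_simps)
      then show "(\<Sum>j<N. \<Sum>k<N. \<psi> j w * \<psi> k w * cos (of_int (int j - int k) * x))
          = (\<Sum>j<N. \<psi> j w * cos (real j * x))\<^sup>2 + (\<Sum>j<N. \<psi> j w * sin (real j * x))\<^sup>2"
        unfolding power2_eq_square sum_product by (simp only: sum.distrib)
    qed
    also have "\<dots> \<ge> 0" by (intro Bochner_Integration.integral_nonneg) auto
    finally show ?thesis .
  qed
  have r0: "r 0 \<le> 1"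
  proof -
    have "r 0 \<le> measure M A - \<alpha>\<^sup>2"
      unfolding r_def using A by (intro diff_right_mono finite_measure_mono) auto
    then show ?thesis using \<alpha> by (simp add: \<alpha>_def[symmetric]) (smt (verit) zero_le_power2)
  qed
  have "0 \<le> (\<Sum>j<N. \<Sum>k<N. b (nat \<bar>int j - int k\<bar>) * cos (of_int (int j - int k) * x))" for N x
  proof -
    have "(\<Sum>j<N. \<Sum>k<N. b (nat \<bar>int j - int k\<bar>) * cos (of_int (int j - int k) * x))
      = (\<Sum>j<N. \<Sum>k<N. r (nat \<bar>int j - int k\<bar>) * cos (of_int (int j - int k) * x) + (if k = j then 1 - r 0 else 0))"
      by (intro sum.cong refl) (auto simp: b_def)
    also have "\<dots> = (\<Sum>j<N. \<Sum>k<N. r (nat \<bar>int j - int k\<bar>) * cos (of_int (int j - int k) * x)) + (\<Sum>j<N. 1 - r 0)"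
      by (simp add: sum.distrib)
    finally show ?thesis using pos_def[of x N] r0 by simp
  qed
  then obtain \<nu> where "real_distribution \<nu>" "AE x in \<nu>. 0 \<le> x \<and> x \<le> 2 * pi"
    "\<And>m. (LINT x|\<nu>. cos (x * real m)) = b m"
    by (rule herglotz[of b, rotated 1]) (auto simp: b_def)
  then show thesis
    by (intro that[of \<nu>]) (auto simp: b_def r_def \<alpha>_def)
qed

end

section \<open>Thickness and syndeticity\<close>

lemma fdiff_funpow_class_F:
  assumes "f \<in> class_F (Suc l)"
  shows "fdiff ((fdiff ^^ l) f) \<in> class_F0"
  using assms
proof (induction l arbitrary: f)
  case (Suc l)
  then have "fdiff f \<in> class_F (Suc l)" by simp
  from Suc.IH[OF this] show ?case by (simp add: funpow_swap1)
qed simp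

text \<open>An eventually monotone null sequence eventually has one sign. The shift by
  \<open>n0\<close> discards the initial stretch, and \<open>\<sigma>\<close> turns increasing
  nonpositive increments into decreasing nonnegative ones.\<close>

lemma class_F0_normalization:
  assumes "fdiff W \<in> class_F0"
  obtains \<sigma> :: real and n0 :: nat where "\<sigma> = 1 \<or> \<sigma> = -1" "n0 \<ge> 1"
    "\<And>n. fdiff (\<lambda>n. \<sigma> * W (n + n0)) n \<ge> 0" "decseq (fdiff (\<lambda>n. \<sigma> * W (n + n0)))"
    "fdiff (\<lambda>n. \<sigma> * W (n + n0)) \<longlonglongrightarrow> 0"
    "filterlim (\<lambda>N. \<Sum>n<N. fdiff (\<lambda>n. \<sigma> * W (n + n0)) n) at_top sequentially"
proof -
  obtain n0 where lim: "fdiff W \<longlonglongrightarrow> 0" and n0: "n0 \<ge> 1"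
    and mono: "mono_on {n0..} (fdiff W) \<or> antimono_on {n0..} (fdiff W)"
    and div: "filterlim (\<lambda>N. \<bar>\<Sum>n=1..N. fdiff W n\<bar>) at_top sequentially"
    using assms unfolding class_F0_def by blast
  define \<sigma> :: real where "\<sigma> = (if antimono_on {n0..} (fdiff W) then 1 else -1)"
  define V where "V = (\<lambda>n. \<sigma> * W (n + n0))"
  have V: "fdiff V n = \<sigma> * fdiff W (n + n0)" for n
    by (simp add: V_def fdiff_def algebra_simps)
  have dec: "decseq (fdiff V)"
    using mono by (auto simp: decseq_def V \<sigma>_def monotone_on_def)
  have lim0: "fdiff V \<longlonglongrightarrow> 0"
    using tendsto_mult_left[OF LIMSEQ_ignore_initial_segment[OF lim, of n0], of \<sigma>] by (simp add: V[abs_def])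
  have nonneg: "fdiff V n \<ge> 0" for n using decseq_ge[OF dec lim0] .
  \<comment> \<open>Divergence is given for sums from 1; the indices below \<open>n0\<close>
    contribute only the fixed amount \<open>W n0 - W 1\<close>.\<close>
  have bound: "\<bar>\<Sum>n=1..N + (n0 - 1). fdiff W n\<bar> \<le> \<bar>W n0 - W 1\<bar> + (\<Sum>n<N. fdiff V n)" for N
  proof -
    have "(\<Sum>n=1..N + (n0 - 1). fdiff W n) = W (N + n0) - W 1"
    proof -
      have "(\<Sum>n=1..N + (n0 - 1). fdiff W n) = (\<Sum>n=1..<N + n0. fdiff W n)"
        using n0 by (intro sum.cong) auto
      also have "\<dots> = W (N + n0) - W 1"
        unfolding fdiff_def using n0 sum_Suc_diff'[of 1 "N + n0" W] by simp
      finally show ?thesis .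
    qed
    moreover have "\<bar>W (N + n0) - W n0\<bar> = (\<Sum>n<N. fdiff V n)"
    proof -
      have "(\<Sum>n<N. fdiff V n) = \<sigma> * (W (N + n0) - W n0)"
        using sum_fdiff_telescope[of V 0 N] by (simp add: V_def right_diff_distrib)
      moreover have "(\<Sum>n<N. fdiff V n) \<ge> 0" by (intro sum_nonneg nonneg)
      ultimately show ?thesis by (auto simp: \<sigma>_def split: if_splits)
    qed
    ultimately show ?thesis by linarith
  qed
  have "filterlim (\<lambda>N. \<bar>\<Sum>n=1..N + (n0 - 1). fdiff W n\<bar>) at_top sequentially"
    by (rule filterlim_compose[OF div filterlim_add_const_nat_at_top])
  then have "filterlim (\<lambda>N. \<bar>W n0 - W 1\<bar> + (\<Sum>n<N. fdiff V n)) at_top sequentially"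
    by (rule filterlim_at_top_mono[OF _ always_eventually]) (intro allI bound)
  then have "filterlim (\<lambda>N. - \<bar>W n0 - W 1\<bar> + (\<bar>W n0 - W 1\<bar> + (\<Sum>n<N. fdiff V n))) at_top sequentially"
    by (rule filterlim_tendsto_add_at_top[OF tendsto_const])
  then have "filterlim (\<lambda>N. \<Sum>n<N. fdiff V n) at_top sequentially" by simp
  from that[OF _ n0 nonneg[unfolded V_def] dec[unfolded V_def] lim0[unfolded V_def] this[unfolded V_def]]
  show thesis by (simp add: \<sigma>_def)
qed

theorem theorem1:
  fixes l :: nat and f W :: "nat \<Rightarrow> real"
    and M :: "'a measure" and T :: "'a \<Rightarrow> 'a" and A :: "'a set" and \<epsilon> :: real
    and R :: "nat set"
  assumes "l \<ge> 1" and "f \<in> class_F l"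
    and "W = (fdiff ^^ (l - 1)) f"
    and "invertible_pmp_system M T" and "A \<in> sets M" and "\<epsilon> > 0"
    and "R = {n. n \<ge> 1 \<and>
           measure M (A \<inter> (int_iterate (space M) T \<lfloor>f n\<rfloor> -` A \<inter> space M)) > (measure M A)\<^sup>2 - \<epsilon>}"
  shows "thick R \<and> syndetic_wrt W R"
proof -
  interpret invertible_pmp_system M T by fact
  obtain l' where l': "l = Suc l'" using assms(1) by (cases l) auto
  then have W: "W = (fdiff ^^ l') f" using assms(3) by simp
  then have "fdiff W \<in> class_F0" using fdiff_funpow_class_F assms(2) l' by blast
  then obtain \<sigma> :: real and n0 :: nat where \<sigma>: "\<sigma> = 1 \<or> \<sigma> = -1" and n0: "n0 \<ge> 1"
    and V_props: "\<And>n. fdiff (\<lambda>n. \<sigma> * W (n + n0)) n \<ge> 0" "decseq (fdiff (\<lambda>n. \<sigma> * W (n + n0)))"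
    "fdiff (\<lambda>n. \<sigma> * W (n + n0)) \<longlonglongrightarrow> 0"
    and div: "filterlim (\<lambda>N. \<Sum>n<N. fdiff (\<lambda>n. \<sigma> * W (n + n0)) n) at_top sequentially"
    by (rule class_F0_normalization) blast
  define V where "V = (\<lambda>n. \<sigma> * W (n + n0))"
  note V_props = V_props[folded V_def]
  have V: "fdiff V n = \<sigma> * fdiff W (n + n0)" for n
    by (simp add: V_def fdiff_def algebra_simps)
  obtain \<nu> where \<nu>: "real_distribution \<nu>" "AE x in \<nu>. 0 \<le> x \<and> x \<le> 2 * pi"
    "\<And>m. m > 0 \<Longrightarrow> measure M (A \<inter> ((T ^^ m) -` A \<inter> space M)) = (measure M A)\<^sup>2 + (LINT x|\<nu>. cos (x * real m))"
    by (rule spectral_measure[OF assms(5)]) blast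
  have R: "n \<in> R" if "n \<ge> 1" and n: "(LINT x|\<nu>. cos (x * real_of_int \<lfloor>f n\<rfloor>)) > - \<epsilon>" for n
  proof -
    define k where "k = \<lfloor>f n\<rfloor>"
    have "measure M (A \<inter> ((T ^^ nat \<bar>k\<bar>) -` A \<inter> space M)) > (measure M A)\<^sup>2 - \<epsilon>"
    \<comment> \<open>The spectral formula excludes 0; there the intersection is \<open>A\<close>
      itself, and a number in [0, 1] is at least its square.\<close>
    proof (cases "k = 0")
      case True
      have "(measure M A)\<^sup>2 \<le> measure M A"
        using mult_left_le[of "measure M A" "measure M A"] by (simp add: power2_eq_square)
      moreover have "A \<inter> ((T ^^ nat \<bar>k\<bar>) -` A \<inter> space M) = A"
        using True sets.sets_into_space[OF assms(5)] by auto
      ultimately show ?thesis using assms(6) by simp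
    next
      case False
      have "cos (x * real (nat \<bar>k\<bar>)) = cos (x * real_of_int k)" for x
        by (cases "k \<ge> 0") auto
      then show ?thesis using \<nu>(3)[of "nat \<bar>k\<bar>"] False n by (simp add: k_def)
    qed
    then show ?thesis using that(1) measure_int_iterate[OF assms(5)] by (simp add: assms(7) k_def)
  qed
  \<comment> \<open>Starting points, in the shifted indexing of \<open>V\<close>, from which
    \<open>m\<close> consecutive times satisfy the spectral criterion for \<open>R\<close>.\<close>
  define G where "G m = {n. \<forall>i<m. (LINT x|\<nu>. cos (x * real_of_int \<lfloor>f (n + i + n0)\<rfloor>)) > - \<epsilon>}" for m
  have G_R: "n + n0 + i \<in> R" if "n \<in> G m" "i < m" for n m i
    using that n0 by (intro R) (auto simp: G_def add_ac)
  have density: "\<exists>\<eta>>0. \<forall>\<^sub>F k in sequentially. \<eta> * (\<Sum>n=a k..<b k. fdiff V n) \<le> (\<Sum>n\<in>{a k..<b k} \<inter> G m. fdiff V n)"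
    if mass: "filterlim (\<lambda>k. \<Sum>n=a k..<b k. fdiff V n) at_top sequentially" for a b m
  proof -
    interpret weighted_averages V a b
      using V_props mass by unfold_locales auto
    \<comment> \<open>Since \<open>\<sigma> * \<sigma> = 1\<close>, the shifted \<open>f\<close> has
      leading constant \<open>\<sigma>\<close> relative to \<open>V\<close>, without error
      term.\<close>
    have "(fdiff ^^ l') (\<lambda>n. f (n + n0)) n - \<sigma> * V n = 0" for n
      using \<sigma> by (auto simp: fdiff_funpow_shift V_def W)
    then have "convergent (\<lambda>n. (fdiff ^^ l') (\<lambda>n. f (n + n0)) n - \<sigma> * V n)"
      by (simp add: convergent_const)
    then have "tempered (Suc l') (\<lambda>n. f (n + n0))"
      unfolding tempered.simps using \<sigma> by (intro exI[of _ \<sigma>]) auto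
    from returns_positive_lower_density[OF \<nu>(1,2) this assms(6), of m]
    show ?thesis by (simp add: mass_def G_def)
  qed
  \<comment> \<open>Along initial segments positive density yields an element of \<open>G L\<close>,
    and one element already gives \<open>L\<close> consecutive members of \<open>R\<close>.\<close>
  have "thick R"
    unfolding thick_def
  proof
    fix L
    have div0: "filterlim (\<lambda>k. \<Sum>n=0..<k. fdiff V n) at_top sequentially"
      using div by (simp add: V_def atLeast0LessThan)
    obtain \<eta> where \<eta>: "\<eta> > 0"
      "\<forall>\<^sub>F k in sequentially. \<eta> * (\<Sum>n=0..<k. fdiff V n) \<le> (\<Sum>n\<in>{0..<k} \<inter> G L. fdiff V n)"
      using density[OF div0, of L] by blast
    have "\<forall>\<^sub>F k in sequentially. (\<Sum>n=0..<k. fdiff V n) > 0"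
      using div0 by (simp add: filterlim_at_top_dense)
    with \<eta>(2) have "\<forall>\<^sub>F k in sequentially. {0..<k} \<inter> G L \<noteq> {}"
    proof eventually_elim
      case (elim k)
      have "0 < \<eta> * (\<Sum>n=0..<k. fdiff V n)" using elim(2) \<eta>(1) by simp
      with elim(1) show ?case by auto
    qed
    then obtain n where "n \<in> G L" by (auto simp: eventually_sequentially)
    then have "{n + n0..<n + n0 + L} \<subseteq> R"
      using G_R by (metis atLeastLessThan_iff le_iff_add nat_add_left_cancel_less subsetI)
    then show "\<exists>m\<ge>1. {m..<m + L} \<subseteq> R" using n0 by (intro exI[of _ "n + n0"]) auto
  qed
  moreover have "syndetic_wrt W R"
  proof (rule ccontr)
    \<comment> \<open>Below \<open>n0\<close> the increments of \<open>W\<close> may have either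
      sign; \<open>C\<close> bounds their contribution to any sum.\<close>
    define C where "C = (\<Sum>n<n0. \<bar>fdiff W n\<bar>)"
    have small: "\<bar>\<Sum>n\<in>X \<inter> {..<n0}. fdiff W n\<bar> \<le> C" for X
      unfolding C_def by (rule order_trans[OF sum_abs sum_mono2]) auto
    have split: "\<bar>(\<Sum>n\<in>X. fdiff W n) - (\<Sum>n\<in>X \<inter> {n0..}. fdiff W n)\<bar> \<le> C" if "finite X" for X
    proof -
      have "(\<Sum>n\<in>X. fdiff W n) = (\<Sum>n\<in>X \<inter> {n0..}. fdiff W n) + (\<Sum>n\<in>X \<inter> {..<n0}. fdiff W n)"
        using sum.Int_Diff[OF that, of "fdiff W" "{n0..}"] by (simp add: Diff_eq Compl_atLeast)
      then show ?thesis using small[of X] by simp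
    qed
    have telescope: "(\<Sum>n=a..<b. fdiff W n) = W b - W a" if "a \<le> b" for a b
      unfolding fdiff_def using sum_Suc_diff'[OF that, of W] by simp
    assume not_syndetic: "\<not> syndetic_wrt W R"
    \<comment> \<open>Failure of every constant \<open>Suc k\<close> supplies intervals of unbounded
      growth on which the returns weigh less than 1.\<close>
    have "\<exists>a b. 1 \<le> a \<and> a \<le> b \<and> W b - W a \<ge> real (Suc k) \<and> (\<Sum>n\<in>R \<inter> {a..b}. fdiff W n) < 1" for k
    proof (rule ccontr)
      assume "\<not> ?thesis"
      then have "syndetic_wrt W R"
        unfolding syndetic_wrt_def by (intro exI[of _ "Suc k"] conjI) (simp, meson not_less)
      with not_syndetic show False ..
    qed
    then obtain a b where ab: "\<And>k. a k \<le> b k" "\<And>k. W (b k) - W (a k) \<ge> real (Suc k)"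
      "\<And>k. (\<Sum>n\<in>R \<inter> {a k..b k}. fdiff W n) < 1"
      by metis
    have tail: "(\<Sum>n\<in>{a k..<b k} \<inter> {n0..}. fdiff W n) \<ge> real (Suc k) - C" for k
      using split[of "{a k..<b k}"] telescope[OF ab(1), of k] ab(2)[of k] by simp
    \<comment> \<open>If \<open>W\<close> is eventually decreasing, its increments \<open>W N - W M\<close> are bounded above.\<close>
    have "\<sigma> = 1"
    proof (rule ccontr)
      assume "\<sigma> \<noteq> 1"
      then have "fdiff W n \<le> 0" if "n \<ge> n0" for n
        using V_props(1)[of "n - n0"] \<sigma> that by (auto simp: V)
      then have "(\<Sum>n\<in>{a k..<b k} \<inter> {n0..}. fdiff W n) \<le> 0" for k
        by (intro sum_nonpos) auto
      then have "real (Suc k) \<le> C" for k using tail[of k] by (meson diff_le_0_iff_le order_trans)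
      moreover obtain k where "C < real k" using reals_Archimedean2 by blast
      ultimately show False by (metis lessI less_le_trans not_le of_nat_less_iff order_less_trans)
    qed
    then have W_V: "fdiff W (n + n0) = fdiff V n" for n by (simp add: V)
    have shift: "(\<Sum>n\<in>X. fdiff V n) = (\<Sum>n\<in>(\<lambda>n. n + n0) ` X. fdiff W n)" for X
      by (simp add: sum.reindex W_V)
    \<comment> \<open>Truncated subtraction drops exactly the indices below \<open>n0\<close>, even
      if the interval begins or ends there.\<close>
    have image: "(\<lambda>n. n + n0) ` {a k - n0..<b k - n0} = {a k..<b k} \<inter> {n0..}" for k
    proof -
      have "(\<lambda>n. n + n0) ` {a k - n0..<b k - n0} = {a k - n0 + n0..<b k - n0 + n0}"
        by (rule image_add_atLeastLessThan')
      then show ?thesis by (auto split: nat_diff_split)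
    qed
    have mass_ge: "(\<Sum>n=a k - n0..<b k - n0. fdiff V n) \<ge> real (Suc k) - C" for k
      unfolding shift image by (rule tail)
    have lim: "filterlim (\<lambda>k. \<Sum>n=a k - n0..<b k - n0. fdiff V n) at_top sequentially"
    proof (rule filterlim_at_top_mono[OF _ always_eventually])
      show "filterlim (\<lambda>k. real (Suc k) - C) at_top sequentially" by real_asymp
    qed (intro allI mass_ge)
    obtain \<eta> where \<eta>: "\<eta> > 0" "\<forall>\<^sub>F k in sequentially. \<eta> * (\<Sum>n=a k - n0..<b k - n0. fdiff V n)
        \<le> (\<Sum>n\<in>{a k - n0..<b k - n0} \<inter> G 1. fdiff V n)"
      using density[OF lim, of 1] by blast
    \<comment> \<open>Beyond this mass the returns from \<open>n0\<close> on weigh more than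
      \<open>1 + C\<close>, hence all returns in the interval more than 1, against the choice of the
      intervals.\<close>
    have "\<forall>\<^sub>F k in sequentially. (\<Sum>n=a k - n0..<b k - n0. fdiff V n) > (1 + C) / \<eta>"
      using lim by (simp add: filterlim_at_top_dense)
    with \<eta>(2) have "\<forall>\<^sub>F k in sequentially. False"
    proof eventually_elim
      case (elim k)
      have "1 + C < \<eta> * (\<Sum>n=a k - n0..<b k - n0. fdiff V n)"
        using elim(2) \<eta>(1) by (simp add: field_simps)
      also note elim(1)
      also have "(\<Sum>n\<in>{a k - n0..<b k - n0} \<inter> G 1. fdiff V n)
          \<le> (\<Sum>n\<in>(R \<inter> {a k..b k}) \<inter> {n0..}. fdiff W n)"
        unfolding shift
      proof (rule sum_mono2)
        show "(\<lambda>n. n + n0) ` ({a k - n0..<b k - n0} \<inter> G 1) \<subseteq> (R \<inter> {a k..b k}) \<inter> {n0..}"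
          using G_R[of _ 1 0] by auto
        \<comment> \<open>Covers in particular the right end \<open>b k\<close>, absent from the
          half-open interval.\<close>
        show "fdiff W n \<ge> 0" if "n \<in> (R \<inter> {a k..b k}) \<inter> {n0..} - (\<lambda>n. n + n0) ` ({a k - n0..<b k - n0} \<inter> G 1)" for n
          using that V_props(1)[of "n - n0"] by (simp add: W_V[symmetric])
      qed simp
      also have "\<dots> \<le> (\<Sum>n\<in>R \<inter> {a k..b k}. fdiff W n) + C"
        using split[of "R \<inter> {a k..b k}"] by simp
      finally show ?case using ab(3)[of k] by simp
    qed
    then show False by simp
  qed
  ultimately show ?thesis ..
qed

end
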